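(* Let $\Gamma$ be a discrete abelian group and let $F \subseteq \Gamma$ be any infinite subset. Then there are countable, disjoint sets $E \subseteq F$ and $E' \subseteq F+F-F$ such that both $E$ and $E'$ are $I_0$ sets, but $E \cup E'$ is not an $I_0$ set. Furthermore, the sets $E, E'$ can be chosen so that, in addition, both are weak $\varepsilon$-Kronecker for some $\varepsilon \le \sqrt{2}$.
   Context: $\Gamma$ is a discrete abelian group, written additively, and $G$ is its compact dual group; elements of $\Gamma$ are regarded as continuous characters $\gamma : G \to \mathbb{T}$, where $\mathbb{T}$ is the group of complex numbers of modulus one. $F+F-F = \{f_1+f_2-f_3 : f_1,f_2,f_3 \in F\}$. For a (finite, complex, regular Borel) measure $\mu$ on $G$, $\widehat{\mu}(\gamma) = \int_G \overline{\gamma}\, d\mu$. A subset $E \subseteq \Gamma$ is an $I_0$ set if for every bounded function $\phi : E \to \mathbb{C}$ there is a discrete measure $\mu$ on $G$ (i.e. $\mu = \sum_k a_k \delta_{x_k}$ with $x_k\in G$ and $\sum_k |a_k| < \infty$) with $\widehat{\mu}(\gamma) = \phi(\gamma)$ for all $\gamma \in E$. A subset $E \subseteq \Gamma$ is weak $\varepsilon$-Kronecker if for every $\phi : E \to \mathbb{T}$ there exists $x \in G$ such that $|\phi(\gamma) - \gamma(x)| \le \varepsilon$ for all $\gamma \in E$. *)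

theory Defs
  imports "HOL-Analysis.Analysis"
begin

text \<open>
  The discrete group \<open>\<Gamma>\<close> is the universe of a type of class \<^class>\<open>ab_group_add\<close>. Its compact dual
  \<open>G\<close> is the set of homomorphisms from \<open>\<Gamma>\<close> to the unit circle with the topology of pointwise
  convergence, which is the subspace topology inherited from the product topology on
  \<open>'a \<Rightarrow> complex\<close>. An element \<open>\<gamma>\<close> of \<open>\<Gamma>\<close> acts on \<open>G\<close> as the character \<open>\<lambda>x. x \<gamma>\<close>.
\<close>

definition dual_group :: "('a::ab_group_add \<Rightarrow> complex) set" where
  "dual_group = {x. (\<forall>\<gamma>. norm (x \<gamma>) = 1) \<and> (\<forall>\<gamma> \<delta>. x (\<gamma> + \<delta>) = x \<gamma> * x \<delta>)}"

definition dual_borel :: "('a::ab_group_add \<Rightarrow> complex) measure" where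
  "dual_borel = restrict_space borel dual_group"

text \<open>
  A complex measure on a measurable space \<open>M\<close> is represented by its set function \<open>\<nu>\<close>, of which only
  the values on \<^term>\<open>sets M\<close> matter; the measure component of \<open>M\<close> itself is irrelevant.
  Integration with respect to \<open>\<nu>\<close> goes through the Jordan decompositions of its real and imaginary
  parts, the positive variation of \<open>u\<close> being \<open>A \<mapsto> sup {u B | B \<subseteq> A}\<close>.
\<close>

definition positive_variation :: "'b measure \<Rightarrow> ('b set \<Rightarrow> real) \<Rightarrow> 'b measure" where
  "positive_variation M u =
     measure_of (space M) (sets M) (\<lambda>A. SUP B\<in>{B \<in> sets M. B \<subseteq> A}. ennreal (u B))"

definition complex_measure_integral ::
    "'b measure \<Rightarrow> ('b set \<Rightarrow> complex) \<Rightarrow> ('b \<Rightarrow> complex) \<Rightarrow> complex" where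
  "complex_measure_integral M \<nu> f =
     (\<integral>x. f x \<partial>positive_variation M (\<lambda>A. Re (\<nu> A)))
     - (\<integral>x. f x \<partial>positive_variation M (\<lambda>A. - Re (\<nu> A)))
     + \<i> * ((\<integral>x. f x \<partial>positive_variation M (\<lambda>A. Im (\<nu> A)))
           - (\<integral>x. f x \<partial>positive_variation M (\<lambda>A. - Im (\<nu> A))))"

definition fourier_stieltjes ::
    "(('a::ab_group_add \<Rightarrow> complex) set \<Rightarrow> complex) \<Rightarrow> 'a \<Rightarrow> complex" where
  "fourier_stieltjes \<nu> \<gamma> = complex_measure_integral dual_borel \<nu> (\<lambda>x. cnj (x \<gamma>))"

text \<open>
  The point mass at \<open>x\<close> is \<open>\<lambda>A. indicator A x\<close>. The points \<open>x k\<close> need not be distinct and the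
  coefficients may vanish, so finite sums are included.
\<close>

definition discrete_measure :: "(('a::ab_group_add \<Rightarrow> complex) set \<Rightarrow> complex) \<Rightarrow> bool" where
  "discrete_measure \<nu> \<longleftrightarrow>
     (\<exists>(a :: nat \<Rightarrow> complex) x. summable (\<lambda>k. norm (a k)) \<and> (\<forall>k. x k \<in> dual_group) \<and>
        (\<forall>A\<in>sets dual_borel. \<nu> A = (\<Sum>k. a k * indicator A (x k))))"

definition I0_set :: "'a::ab_group_add set \<Rightarrow> bool" where
  "I0_set E \<longleftrightarrow>
     (\<forall>\<phi> :: 'a \<Rightarrow> complex. bounded (\<phi> ` E) \<longrightarrow>
        (\<exists>\<nu>. discrete_measure \<nu> \<and> (\<forall>\<gamma>\<in>E. fourier_stieltjes \<nu> \<gamma> = \<phi> \<gamma>)))"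

definition weak_Kronecker :: "real \<Rightarrow> 'a::ab_group_add set \<Rightarrow> bool" where
  "weak_Kronecker \<epsilon> E \<longleftrightarrow>
     (\<forall>\<phi> :: 'a \<Rightarrow> complex. (\<forall>\<gamma>\<in>E. norm (\<phi> \<gamma>) = 1) \<longrightarrow>
        (\<exists>x\<in>dual_group. \<forall>\<gamma>\<in>E. norm (\<phi> \<gamma> - x \<gamma>) \<le> \<epsilon>))"

text \<open>
  For a discrete measure the integral above is the expected absolutely convergent series. The real
  and imaginary parts are purely atomic, so their positive variations can be computed atom by atom;
  repeated points are first collected into one atom.
\<close>

lemma positive_variation_atoms:
  fixes c :: "'b \<Rightarrow> real"
  assumes sing: "\<And>y. y \<in> space M \<Longrightarrow> {y} \<in> sets M"
    and c: "c summable_on space M"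
    and u: "\<And>A. A \<in> sets M \<Longrightarrow> u A = infsum c A"
  shows "positive_variation M u =
    distr (density (count_space (space M)) (\<lambda>y. ennreal (max 0 (c y)))) M (\<lambda>y. y)"
    (is "_ = ?N")
proof -
  let ?p = "\<lambda>y. max 0 (c y)"
  let ?S = "{y \<in> space M. c y \<noteq> 0}"
  have cS: "countable ?S"
    by (rule abs_summable_countable[OF iffD1[OF summable_on_iff_abs_summable_on_real c]])
  have csub: "c summable_on A" if "A \<subseteq> space M" for A
    by (rule summable_on_subset_banach[OF c that])
  have nsub: "(\<lambda>y. norm (c y)) summable_on A" if "A \<subseteq> space M" for A
    by (rule iffD1[OF summable_on_iff_abs_summable_on_real csub[OF that]])
  have psub: "?p summable_on A" if "A \<subseteq> space M" for A
    by (rule summable_on_comparison_test[OF nsub[OF that]]) auto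
  have pos: "(SUP B\<in>{B \<in> sets M. B \<subseteq> A}. ennreal (u B)) = emeasure ?N A" if A: "A \<in> sets M" for A
  proof -
    have As: "A \<subseteq> space M" using A sets.sets_into_space by blast
    have "Infinite_Set_Sum.abs_summable_on ?p A"
      by (rule iffD1[OF abs_summable_equivalent iffD1[OF summable_on_iff_abs_summable_on_real psub[OF As]]])
    then have e1: "nn_integral (count_space A) ?p = ennreal (infsum ?p A)"
      by (simp add: nn_integral_conv_infsetsum infsetsum_infsum)
    have "emeasure ?N A = (\<integral>\<^sup>+y. ennreal (?p y) * indicator A y \<partial>count_space (space M))"
      using A As by (simp add: emeasure_distr emeasure_density Int_absorb2)
    also have "\<dots> = nn_integral (count_space A) ?p"
      using As by (subst restrict_count_space_subset[OF As, symmetric], subst nn_integral_restrict_space) auto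
    finally have N: "emeasure ?N A = ennreal (infsum ?p A)" using e1 by simp
    have le: "ennreal (u B) \<le> ennreal (infsum ?p A)" if B: "B \<in> sets M" "B \<subseteq> A" for B
    proof -
      have "infsum c B \<le> infsum ?p A"
        by (rule infsum_mono_neutral) (use B As in \<open>auto intro: csub psub\<close>)
      then show ?thesis using u B by (simp add: ennreal_leI)
    qed
    let ?B = "{y \<in> A. 0 < c y}"
    have "(\<Union>y\<in>?B. {y}) \<in> sets M"
      by (rule sets.countable_UN'[OF countable_subset[OF _ cS]]) (use As sing in auto)
    then have B: "?B \<in> sets M" by simp
    have "infsum ?p A = infsum c ?B"
      by (rule infsum_cong_neutral) auto
    then have "ennreal (infsum ?p A) = ennreal (u ?B)" using u B by simp
    then have "(SUP B\<in>{B \<in> sets M. B \<subseteq> A}. ennreal (u B)) = ennreal (infsum ?p A)"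
      using le B by (intro antisym SUP_least SUP_upper2[where i = ?B]) auto
    then show ?thesis using N by simp
  qed
  have "positive_variation M u = measure_of (space M) (sets M) (emeasure ?N)"
    unfolding positive_variation_def
    by (rule measure_of_eq) (auto simp: sets.space_closed sets.sigma_sets_eq pos)
  also have "\<dots> = measure_of (space ?N) (sets ?N) (emeasure ?N)" by simp
  also have "\<dots> = ?N" by (rule measure_of_of_measure)
  finally show ?thesis .
qed

lemma integral_positive_variation_atoms:
  fixes c :: "'b \<Rightarrow> real" and f :: "'b \<Rightarrow> complex"
  assumes sing: "\<And>y. y \<in> space M \<Longrightarrow> {y} \<in> sets M"
    and c: "c summable_on space M"
    and u: "\<And>A. A \<in> sets M \<Longrightarrow> u A = infsum c A"
    and f: "f \<in> borel_measurable M" "\<And>y. y \<in> space M \<Longrightarrow> norm (f y) \<le> K"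
  shows "((\<lambda>y. of_real (max 0 (c y)) * f y) has_sum (\<integral>y. f y \<partial>positive_variation M u)) (space M)"
proof -
  let ?g = "\<lambda>y. of_real (max 0 (c y)) * f y"
  have n: "(\<lambda>y. norm (c y)) summable_on space M"
    by (rule iffD1[OF summable_on_iff_abs_summable_on_real c])
  have "(\<lambda>y. K * norm (c y)) summable_on space M" using n by (rule summable_on_cmult_right)
  then have s: "(\<lambda>y. norm (?g y)) summable_on space M"
  proof (rule summable_on_comparison_test)
    fix y assume "y \<in> space M"
    then have "norm (f y) * \<bar>max 0 (c y)\<bar> \<le> K * \<bar>c y\<bar>"
      using f(2)[of y] order_trans[OF norm_ge_zero f(2)[of y]] by (intro mult_mono) auto
    then show "norm (?g y) \<le> K * norm (c y)" by (simp add: norm_mult mult.commute)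
  qed auto
  then have g: "?g summable_on space M" by (rule abs_summable_summable)
  have "(\<integral>y. f y \<partial>positive_variation M u)
      = (\<integral>y. f y \<partial>density (count_space (space M)) (\<lambda>y. ennreal (max 0 (c y))))"
    using f(1) by (simp add: positive_variation_atoms[OF sing c u] integral_distr)
  also have "\<dots> = (\<integral>y. max 0 (c y) *\<^sub>R f y \<partial>count_space (space M))"
    by (rule integral_density) auto
  also have "\<dots> = infsetsum ?g (space M)" by (simp add: infsetsum_def scaleR_conv_of_real)
  also have "\<dots> = infsum ?g (space M)"
    by (rule infsetsum_infsum[OF iffD1[OF abs_summable_equivalent s]])
  finally have "(\<integral>y. f y \<partial>positive_variation M u) = infsum ?g (space M)" .
  then show ?thesis using has_sum_infsum[OF g] by simp
qed

lemma complex_measure_integral_discrete: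
  fixes a :: "nat \<Rightarrow> complex" and f :: "'b \<Rightarrow> complex"
  assumes sing: "\<And>y. y \<in> space M \<Longrightarrow> {y} \<in> sets M"
    and a: "summable (\<lambda>k. norm (a k))" and x: "\<And>k. x k \<in> space M"
    and \<nu>: "\<And>A. A \<in> sets M \<Longrightarrow> \<nu> A = (\<Sum>k. a k * indicator A (x k))"
    and f: "f \<in> borel_measurable M" "\<And>y. y \<in> space M \<Longrightarrow> norm (f y) \<le> K"
  shows "complex_measure_integral M \<nu> f = (\<Sum>k. a k * f (x k))"
proof -
  define d where "d y = infsum a {k. x k = y}" for y
  have regroup: "(\<lambda>y. d y * g y) summable_on A \<and>
      infsum (\<lambda>y. d y * g y) A = (\<Sum>k. a k * (indicator A (x k) * g (x k)))"
    if A: "A \<subseteq> space M" and g: "\<And>y. y \<in> space M \<Longrightarrow> norm (g y) \<le> L" for g L A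
  proof -
    let ?h = "\<lambda>k. a k * g (x k)"
    let ?T = "{k. x k \<in> A}"
    have "summable (\<lambda>k. norm (a k) * L)" using a by (rule summable_mult2)
    then have sn: "summable (\<lambda>k. norm (a k * (indicator A (x k) * g (x k))))"
    proof (rule summable_comparison_test[rotated], intro exI[of _ 0] allI impI)
      fix k :: nat
      have "norm (indicator A (x k) * g (x k)) \<le> L"
        using g[OF x[of k]] order_trans[OF norm_ge_zero g[OF x[of k]]]
        by (simp add: indicator_def)
      then show "norm (norm (a k * (indicator A (x k) * g (x k)))) \<le> norm (a k) * L"
        by (simp add: norm_mult mult_left_mono)
    qed
    then have hs: "((\<lambda>k. a k * (indicator A (x k) * g (x k))) has_sum
        (\<Sum>k. a k * (indicator A (x k) * g (x k)))) UNIV"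
      by (intro norm_summable_imp_has_sum) (auto intro: summable_sums summable_norm_cancel)
    then have hT: "(?h has_sum (\<Sum>k. a k * (indicator A (x k) * g (x k)))) ?T"
      by (subst (asm) has_sum_cong_neutral[where T = ?T and g = ?h]) (auto simp: indicator_def)
    have bij: "bij_betw snd (SIGMA y:A. {k. x k = y}) ?T"
      by (rule bij_betwI[where g = "\<lambda>k. (x k, k)"]) auto
    have hS: "((\<lambda>(y, k). ?h k) has_sum (\<Sum>k. a k * (indicator A (x k) * g (x k))))
        (SIGMA y:A. {k. x k = y})"
      using hT has_sum_reindex_bij_betw[OF bij, of ?h] by (simp add: case_prod_unfold)
    have inner: "infsum ?h {k. x k = y} = d y * g y" for y
    proof -
      have "infsum ?h {k. x k = y} = infsum (\<lambda>k. a k * g y) {k. x k = y}"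
        by (rule infsum_cong) auto
      then show ?thesis by (simp add: d_def infsum_cmult_left')
    qed
    have sS: "(\<lambda>(y, k). ?h k) summable_on (SIGMA y:A. {k. x k = y})"
      using hS by (auto simp: summable_on_def)
    show ?thesis
      using summable_on_Sigma_banach[OF sS] infsum_Sigma'_banach[OF sS] infsumI[OF hS]
      by (simp add: inner)
  qed
  have dsum: "d summable_on A" if "A \<subseteq> space M" for A
    using regroup[OF that, of "\<lambda>_. 1" 1] by simp
  have \<nu>d: "\<nu> A = infsum d A" if "A \<in> sets M" for A
    using regroup[of A "\<lambda>_. 1" 1] \<nu>[OF that] sets.sets_into_space[OF that] by simp
  have re: "(\<lambda>y. Re (d y)) summable_on space M" and im: "(\<lambda>y. Im (d y)) summable_on space M"
    using dsum[of "space M"] by (auto intro: summable_on_Re summable_on_Im)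
  have vre: "Re (\<nu> A) = infsum (\<lambda>y. Re (d y)) A" and vim: "Im (\<nu> A) = infsum (\<lambda>y. Im (d y)) A"
    if "A \<in> sets M" for A
    using \<nu>d[OF that] dsum[OF sets.sets_into_space[OF that]] by (auto simp: infsum_Re infsum_Im)
  have mre: "(\<lambda>y. - Re (d y)) summable_on space M" "(\<lambda>y. - Im (d y)) summable_on space M"
    using re im by (auto simp: summable_on_uminus)
  have mv: "- Re (\<nu> A) = infsum (\<lambda>y. - Re (d y)) A" "- Im (\<nu> A) = infsum (\<lambda>y. - Im (d y)) A"
    if "A \<in> sets M" for A
    using vre[OF that] vim[OF that] by (auto simp: infsum_uminus)
  have diff_has_sum: "((\<lambda>y. p y - q y) has_sum P - Q) (space M)"
    if "(p has_sum P) (space M)" "(q has_sum Q) (space M)" for p q :: "'b \<Rightarrow> complex" and P Q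
    using has_sum_add[OF that(1), of "\<lambda>y. - q y" "- Q"] that(2) by (simp add: has_sum_uminus)
  let ?G = "\<lambda>c y. complex_of_real (max 0 (c y)) * f y"
  have I1: "(?G (\<lambda>y. Re (d y)) has_sum (\<integral>y. f y \<partial>positive_variation M (\<lambda>A. Re (\<nu> A)))) (space M)"
    by (rule integral_positive_variation_atoms[OF sing re vre f])
  have I2: "(?G (\<lambda>y. - Re (d y)) has_sum (\<integral>y. f y \<partial>positive_variation M (\<lambda>A. - Re (\<nu> A)))) (space M)"
    by (rule integral_positive_variation_atoms[OF sing mre(1) mv(1) f])
  have I3: "(?G (\<lambda>y. Im (d y)) has_sum (\<integral>y. f y \<partial>positive_variation M (\<lambda>A. Im (\<nu> A)))) (space M)"
    by (rule integral_positive_variation_atoms[OF sing im vim f])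
  have I4: "(?G (\<lambda>y. - Im (d y)) has_sum (\<integral>y. f y \<partial>positive_variation M (\<lambda>A. - Im (\<nu> A)))) (space M)"
    by (rule integral_positive_variation_atoms[OF sing mre(2) mv(2) f])
  have split: "complex_of_real (max 0 (Re z)) - of_real (max 0 (- Re z))
      + \<i> * (of_real (max 0 (Im z)) - of_real (max 0 (- Im z))) = z" for z
    by (simp add: complex_eq_iff max_def)
  have hs: "((\<lambda>y. ?G (\<lambda>y. Re (d y)) y - ?G (\<lambda>y. - Re (d y)) y
        + \<i> * (?G (\<lambda>y. Im (d y)) y - ?G (\<lambda>y. - Im (d y)) y)) has_sum
      complex_measure_integral M \<nu> f) (space M)"
    unfolding complex_measure_integral_def
    by (intro has_sum_add diff_has_sum has_sum_cmult_right I1 I2 I3 I4)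
  have "?G (\<lambda>y. Re (d y)) y - ?G (\<lambda>y. - Re (d y)) y
        + \<i> * (?G (\<lambda>y. Im (d y)) y - ?G (\<lambda>y. - Im (d y)) y) = d y * f y" for y
    using arg_cong[OF split[of "d y"], of "\<lambda>z. z * f y"] by (simp add: algebra_simps)
  with hs have "((\<lambda>y. d y * f y) has_sum complex_measure_integral M \<nu> f) (space M)" by simp
  then have "complex_measure_integral M \<nu> f = infsum (\<lambda>y. d y * f y) (space M)"
    by (simp add: infsumI)
  also have "\<dots> = (\<Sum>k. a k * (indicator (space M) (x k) * f (x k)))"
    using regroup[of "space M" f K] f(2) by simp
  also have "\<dots> = (\<Sum>k. a k * f (x k))" using x by simp
  finally show ?thesis .
qed

lemma space_dual_borel: "space dual_borel = dual_group"
  by (simp add: dual_borel_def space_restrict_space)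

lemma singleton_in_dual_borel: "y \<in> dual_group \<Longrightarrow> {y} \<in> sets dual_borel"
proof -
  assume y: "y \<in> dual_group"
  have "closed {z :: 'a \<Rightarrow> complex. z \<gamma> = y \<gamma>}" for \<gamma>
    by (intro closed_Collect_eq continuous_on_product_coordinates continuous_on_const)
  then have "closed (\<Inter>\<gamma>. {z :: 'a \<Rightarrow> complex. z \<gamma> = y \<gamma>})" by (intro closed_INT ballI)
  moreover have "(\<Inter>\<gamma>. {z :: 'a \<Rightarrow> complex. z \<gamma> = y \<gamma>}) = {y}" by auto
  ultimately have "{y} \<in> sets borel" by (simp only: borel_closed)
  then show ?thesis unfolding dual_borel_def sets_restrict_space
    by (rule image_eqI[rotated]) (use y in simp)
qed

lemma fourier_stieltjes_discrete:
  assumes "summable (\<lambda>k. norm (a k))" "\<And>k. x k \<in> dual_group"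
    and "\<And>A. A \<in> sets dual_borel \<Longrightarrow> \<nu> A = (\<Sum>k. a k * indicator A (x k))"
  shows "fourier_stieltjes \<nu> \<gamma> = (\<Sum>k. a k * cnj (x k \<gamma>))"
  unfolding fourier_stieltjes_def
proof (rule complex_measure_integral_discrete[OF _ assms(1) _ assms(3)])
  show "(\<lambda>y :: 'a \<Rightarrow> complex. cnj (y \<gamma>)) \<in> borel_measurable dual_borel"
    unfolding dual_borel_def
    by (intro measurable_restrict_space1 borel_measurable_continuous_onI continuous_on_cnj
        continuous_on_product_coordinates)
  show "norm (cnj (y \<gamma>)) \<le> 1" if "y \<in> space dual_borel" for y :: "'a \<Rightarrow> complex"
    using that by (simp add: space_dual_borel dual_group_def)
qed (use assms(2) in \<open>auto simp: space_dual_borel singleton_in_dual_borel\<close>)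

lemma I0_set_iff_series:
  fixes E :: "'a::ab_group_add set"
  shows "I0_set E \<longleftrightarrow>
     (\<forall>\<phi> :: 'a \<Rightarrow> complex. bounded (\<phi> ` E) \<longrightarrow>
        (\<exists>(a :: nat \<Rightarrow> complex) x. summable (\<lambda>k. norm (a k)) \<and> (\<forall>k. x k \<in> dual_group) \<and>
           (\<forall>\<gamma>\<in>E. (\<Sum>k. a k * cnj (x k \<gamma>)) = \<phi> \<gamma>)))"
proof -
  have "(\<exists>\<nu>. discrete_measure \<nu> \<and> (\<forall>\<gamma>\<in>E. fourier_stieltjes \<nu> \<gamma> = \<phi> \<gamma>)) \<longleftrightarrow>
      (\<exists>(a :: nat \<Rightarrow> complex) x. summable (\<lambda>k. norm (a k)) \<and> (\<forall>k. x k \<in> dual_group) \<and>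
           (\<forall>\<gamma>\<in>E. (\<Sum>k. a k * cnj (x k \<gamma>)) = \<phi> \<gamma>))" (is "?L \<longleftrightarrow> ?R") for \<phi> :: "'a \<Rightarrow> complex"
  proof
    assume ?L
    then show ?R
    proof (elim exE conjE)
      fix \<nu> :: "('a \<Rightarrow> complex) set \<Rightarrow> complex"
      assume \<nu>: "discrete_measure \<nu>" and E: "\<forall>\<gamma>\<in>E. fourier_stieltjes \<nu> \<gamma> = \<phi> \<gamma>"
      from \<nu> show ?R unfolding discrete_measure_def
      proof (elim exE conjE)
        fix a :: "nat \<Rightarrow> complex" and x :: "nat \<Rightarrow> 'a \<Rightarrow> complex"
        assume a: "summable (\<lambda>k. norm (a k))" and x: "\<forall>k. x k \<in> dual_group"
          and \<nu>': "\<forall>A\<in>sets dual_borel. \<nu> A = (\<Sum>k. a k * indicator A (x k))"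
        have "(\<Sum>k. a k * cnj (x k \<gamma>)) = fourier_stieltjes \<nu> \<gamma>" for \<gamma>
          by (rule fourier_stieltjes_discrete[OF a spec[OF x] bspec[OF \<nu>'], symmetric])
        with E have "\<forall>\<gamma>\<in>E. (\<Sum>k. a k * cnj (x k \<gamma>)) = \<phi> \<gamma>" by (simp only:)
        with a x show ?R by (intro exI conjI)
      qed
    qed
  next
    assume ?R
    then show ?L
    proof (elim exE conjE)
      fix a :: "nat \<Rightarrow> complex" and x :: "nat \<Rightarrow> 'a \<Rightarrow> complex"
      assume a: "summable (\<lambda>k. norm (a k))" and x: "\<forall>k. x k \<in> dual_group"
        and E: "\<forall>\<gamma>\<in>E. (\<Sum>k. a k * cnj (x k \<gamma>)) = \<phi> \<gamma>"
      define \<nu> :: "('a \<Rightarrow> complex) set \<Rightarrow> complex"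
        where "\<nu> = (\<lambda>A. \<Sum>k. a k * indicator A (x k))"
      have \<nu>: "\<nu> A = (\<Sum>k. a k * indicator A (x k))" for A by (simp only: \<nu>_def)
      have "discrete_measure \<nu>" unfolding discrete_measure_def
        by (intro exI[of _ a] exI[of _ x] conjI ballI a x \<nu>)
      have "fourier_stieltjes \<nu> \<gamma> = (\<Sum>k. a k * cnj (x k \<gamma>))" for \<gamma>
        by (rule fourier_stieltjes_discrete[OF a spec[OF x] \<nu>])
      with E have "\<forall>\<gamma>\<in>E. fourier_stieltjes \<nu> \<gamma> = \<phi> \<gamma>" by (simp only:)
      with \<open>discrete_measure \<nu>\<close> show ?L by (intro exI conjI)
    qed
  qed
  then show ?thesis by (simp only: I0_set_def)
qed

end

theory Submission
  imports Defs
begin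

text \<open>
  Fix an injective sequence \<open>f\<close> in \<open>F\<close>, let \<open>h\<close> enumerate the differences \<open>f i - f j\<close> with \<open>i < j\<close>, and
  take \<open>E = {g n}\<close>, \<open>E' = {g n + h n}\<close>. Any finitely many characters nearly agree at two terms of
  \<open>f\<close>, so no discrete measure can have transform \<open>1\<close> on \<open>E\<close> and \<open>0\<close> on \<open>E'\<close>. It remains to choose
  \<open>g n \<in> F\<close> so independent of \<open>h 0, \<dots>, h n\<close> and of the earlier \<open>g m\<close> that \<open>E\<close> and \<open>E'\<close> can
  both be interpolated. Three cases suffice.

  If some additive \<open>p : \<Gamma> \<rightarrow> \<real>\<close> is unbounded on \<open>F\<close>, choose the \<open>p (g n)\<close> lacunary and use the
  characters \<open>exp (i s p)\<close>. Otherwise \<open>F\<close> and \<open>2F\<close> meet every finitely generated subgroup in a finite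
  set. If for each such subgroup there is a \<open>g \<in> F\<close> with \<open>g\<close> and \<open>2g\<close> outside it, a character of
  the subgroup extends with its value at \<open>g\<close> prescribed up to a root of unity of order at least \<open>3\<close>,
  which gives the weak Kronecker property with constant \<open>6/5 < \<surd>2\<close>. In the remaining case \<open>2g\<close> is
  a constant \<open>c\<close> on an infinite subset of \<open>F\<close>, and characters trivial on \<open>c\<close> take
  arbitrarily prescribed signs on \<open>E\<close> and on \<open>E'\<close>.
\<close>

section \<open>Extension of characters\<close>

primrec nmul :: "nat \<Rightarrow> 'a::ab_group_add \<Rightarrow> 'a" where
  "nmul 0 g = 0"
| "nmul (Suc n) g = g + nmul n g"

definition zmul :: "int \<Rightarrow> 'a::ab_group_add \<Rightarrow> 'a" where
  "zmul k g = nmul (nat k) g - nmul (nat (- k)) g"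

lemma nmul_add: "nmul (m + n) g = nmul m g + nmul n g"
  by (induction m) (auto simp: algebra_simps)

lemma nmul_plus: "nmul n (g + h) = nmul n g + nmul n h"
  by (induction n) (auto simp: algebra_simps)

text \<open>Frees \<open>zmul\<close> from its positive and negative parts: an integer may be
  written as any difference of naturals, which turns additivity in the integer into a computation
  with \<open>nmul\<close>.\<close>

lemma zmul_diff: "zmul (int m - int n) g = nmul m g - nmul n g"
proof (cases "m \<ge> n")
  case True
  then have "nmul m g = nmul (m - n) g + nmul n g" by (simp flip: nmul_add)
  with True show ?thesis by (simp add: zmul_def flip: of_nat_diff)
next
  case False
  then have "nmul n g = nmul (n - m) g + nmul m g" by (simp flip: nmul_add)
  with False show ?thesis by (simp add: zmul_def flip: of_nat_diff)
qed

lemma zmul_add: "zmul (j + k) g = zmul j g + zmul k g"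
proof -
  obtain a b c d where "j = int a - int b" "k = int c - int d"
    by (metis int_diff_cases)
  moreover have "int a - int b + (int c - int d) = int (a + c) - int (b + d)" by simp
  ultimately show ?thesis by (simp only: zmul_diff nmul_add) (simp add: algebra_simps)
qed

lemma zmul_simps [simp]: "zmul 0 g = 0" "zmul 1 g = g" "zmul (- k) g = - zmul k g"
  by (simp_all add: zmul_def)

lemma zmul_plus: "zmul k (g + h) = zmul k g + zmul k h"
  by (simp add: zmul_def nmul_plus algebra_simps)

lemma zmul_diff_left: "zmul (j - k) g = zmul j g - zmul k g"
  using zmul_add[of j "- k" g] by simp

lemma zmul_mult: "zmul j (zmul k g) = zmul (j * k) g"
proof (induction j rule: int_induct[where k = 0])
  case (step1 i) then show ?case by (simp add: zmul_add distrib_right)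
next
  case (step2 i) then show ?case by (simp add: zmul_diff_left left_diff_distrib)
qed simp

text \<open>Subgroups become submodules, and finitely generated subgroups become spans of finite
  sets, so their closure properties come from module theory.\<close>

interpretation int_module: module zmul
  by unfold_locales (auto simp: zmul_plus zmul_add zmul_mult)

abbreviation generated :: "'a::ab_group_add set \<Rightarrow> 'a set" where
  "generated \<equiv> int_module.span"

lemma zmul_in_subgroup:
  assumes "int_module.subspace H" "g \<in> H" shows "zmul k g \<in> H"
  using assms by (rule int_module.subspace_scale)

section \<open>Homomorphisms into the nonzero complex numbers and their extension\<close>

text \<open>The target is the whole multiplicative group rather than the circle, so that one
  extension theorem serves both for characters, by \<open>sgn\<close>, and for real
  homomorphisms.\<close>

definition cstar_hom_on :: "'a::ab_group_add set \<Rightarrow> ('a \<Rightarrow> complex) \<Rightarrow> bool" where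
  "cstar_hom_on H x \<longleftrightarrow> int_module.subspace H \<and> (\<forall>g\<in>H. x g \<noteq> 0) \<and>
     (\<forall>g\<in>H. \<forall>h\<in>H. x (g + h) = x g * x h)"

lemma cstar_hom_on_0:
  assumes "cstar_hom_on H x" shows "x 0 = 1"
proof -
  have "0 \<in> H" using assms by (auto simp: cstar_hom_on_def int_module.subspace_0)
  then have "x 0 \<noteq> 0" "x (0 + 0) = x 0 * x 0" using assms unfolding cstar_hom_on_def by blast+
  then show ?thesis by simp
qed

lemma cstar_hom_on_zmul:
  assumes "cstar_hom_on H x" "g \<in> H" shows "x (zmul k g) = x g powi k"
proof (induction k rule: int_induct[where k = 0])
  case base then show ?case using cstar_hom_on_0[OF assms(1)] by simp
next
  case (step1 i)
  have "zmul i g \<in> H" using assms by (auto simp: cstar_hom_on_def zmul_in_subgroup)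
  then have "x (zmul i g + g) = x (zmul i g) * x g" using assms unfolding cstar_hom_on_def by blast
  moreover have "x g \<noteq> 0" using assms unfolding cstar_hom_on_def by blast
  ultimately show ?case using step1 by (simp add: zmul_add power_int_add)
next
  case (step2 i)
  have "zmul (i - 1) g \<in> H" using assms by (auto simp: cstar_hom_on_def zmul_in_subgroup)
  then have "x (zmul (i - 1) g + g) = x (zmul (i - 1) g) * x g"
    using assms unfolding cstar_hom_on_def by blast
  moreover have "x g \<noteq> 0" using assms unfolding cstar_hom_on_def by blast
  ultimately show ?case using step2 by (simp add: zmul_diff_left power_int_diff)
qed

lemma cstar_hom_on_diff:
  assumes "cstar_hom_on H x" "g \<in> H" "h \<in> H" shows "x (g - h) = x g / x h"
proof -
  have "g - h \<in> H" using assms by (auto simp: cstar_hom_on_def int_module.subspace_diff)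
  then have "x (g - h + h) = x (g - h) * x h" using assms unfolding cstar_hom_on_def by blast
  moreover have "x h \<noteq> 0" using assms unfolding cstar_hom_on_def by blast
  ultimately show ?thesis by simp
qed

text \<open>The value at \<open>h + zmul k g\<close> is forced to be \<open>x h * z powi k\<close>;
  \<open>compat\<close> is what makes it independent of the representation.\<close>

lemma cstar_hom_extend_one:
  assumes x: "cstar_hom_on H x" and z: "z \<noteq> 0"
    and compat: "\<And>k. zmul k g \<in> H \<Longrightarrow> x (zmul k g) = z powi k"
  shows "\<exists>H' y. cstar_hom_on H' y \<and> H \<subseteq> H' \<and> g \<in> H' \<and> (\<forall>h\<in>H. y h = x h) \<and> y g = z"
proof -
  have H: "int_module.subspace H" using x by (simp add: cstar_hom_on_def)
  define H' where "H' = {h + zmul k g | h k. h \<in> H}"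
  define y where "y u = (SOME v. \<exists>h k. h \<in> H \<and> u = h + zmul k g \<and> v = x h * z powi k)" for u
  have y: "y (h + zmul k g) = x h * z powi k" if h: "h \<in> H" for h k
  proof -
    have "\<exists>h' k'. h' \<in> H \<and> h + zmul k g = h' + zmul k' g \<and> y (h + zmul k g) = x h' * z powi k'"
      unfolding y_def by (rule someI_ex) (use h in blast)
    then obtain h' k' where h': "h' \<in> H" and eq: "h + zmul k g = h' + zmul k' g"
      and yv: "y (h + zmul k g) = x h' * z powi k'" by blast
    \<comment> \<open>Two representations differ by a multiple of \<open>g\<close> that lies in
      \<open>H\<close>.\<close>
    have e: "zmul (k - k') g = h' - h" using eq by (simp add: zmul_diff_left algebra_simps)
    have "h' - h \<in> H" using H h h' by (simp add: int_module.subspace_diff)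
    then have "x (h' - h) = z powi (k - k')" using compat[of "k - k'"] e by simp
    then have "x h' / x h = z powi k / z powi k'"
      using cstar_hom_on_diff[OF x h' h] z by (simp add: power_int_diff)
    moreover have "x h \<noteq> 0" using x h unfolding cstar_hom_on_def by blast
    ultimately show ?thesis using yv z by (simp add: field_simps)
  qed
  have zero: "0 \<in> H" using H by (rule int_module.subspace_0)
  have "cstar_hom_on H' y"
    unfolding cstar_hom_on_def
  proof (intro conjI ballI)
    show "int_module.subspace H'"
      unfolding int_module.subspace_def
    proof (intro conjI ballI allI)
      show "0 \<in> H'" unfolding H'_def using zero by (force intro: exI[of _ 0])
    next
      fix a b assume "a \<in> H'" "b \<in> H'"
      then obtain h k h' k' where "h \<in> H" "h' \<in> H" "a = h + zmul k g" "b = h' + zmul k' g"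
        unfolding H'_def by blast
      moreover from this have "a + b = (h + h') + zmul (k + k') g" by (simp add: zmul_add algebra_simps)
      ultimately show "a + b \<in> H'" unfolding H'_def using int_module.subspace_add[OF H] by blast
    next
      fix c a assume "a \<in> H'"
      then obtain h k where "h \<in> H" "a = h + zmul k g" unfolding H'_def by blast
      moreover from this have "zmul c a = zmul c h + zmul (c * k) g" by (simp add: zmul_plus zmul_mult)
      ultimately show "zmul c a \<in> H'" unfolding H'_def using zmul_in_subgroup[OF H] by blast
    qed
  next
    fix a assume "a \<in> H'"
    then obtain h k where h: "h \<in> H" "a = h + zmul k g" unfolding H'_def by blast
    moreover have "x h \<noteq> 0" using x h unfolding cstar_hom_on_def by blast
    ultimately show "y a \<noteq> 0" using y z by simp
  next
    fix a b assume "a \<in> H'" "b \<in> H'"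
    then obtain h k h' k' where h: "h \<in> H" "h' \<in> H" "a = h + zmul k g" "b = h' + zmul k' g"
      unfolding H'_def by blast
    then have "a + b = (h + h') + zmul (k + k') g" by (simp add: zmul_add algebra_simps)
    then have "y (a + b) = x (h + h') * z powi (k + k')"
      using y int_module.subspace_add[OF H h(1,2)] by simp
    moreover have "x (h + h') = x h * x h'" using x h unfolding cstar_hom_on_def by blast
    ultimately show "y (a + b) = y a * y b" using h y z by (simp add: power_int_add)
  qed
  moreover have "H \<subseteq> H'" unfolding H'_def by (force intro: exI[of _ 0])
  moreover have "0 + zmul 1 g \<in> H'" unfolding H'_def using zero by blast
  moreover have "y h = x h" if "h \<in> H" for h using y[OF that, of 0] by simp
  moreover have "y g = z" using y[OF zero, of 1] cstar_hom_on_0[OF x] by simp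
  ultimately show ?thesis by auto
qed

text \<open>The integers \<open>k\<close> with \<open>zmul k g\<close> in \<open>H\<close> are the
  multiples of the least positive one, so compatibility at \<open>r\<close> suffices.\<close>

lemma root_compat:
  assumes H: "int_module.subspace H" and r: "r > 0" "zmul (int r) g \<in> H"
    and least: "\<And>d. 0 < d \<Longrightarrow> d < r \<Longrightarrow> zmul (int d) g \<notin> H"
    and x: "cstar_hom_on H x" and z: "z ^ r = x (zmul (int r) g)"
    and k: "zmul k g \<in> H"
  shows "x (zmul k g) = z powi k"
proof -
  have kr: "k = k div int r * int r + k mod int r" by simp
  have "zmul (k mod int r) g = zmul k g - zmul (k div int r) (zmul (int r) g)"
    by (simp only: zmul_mult minus_div_mult_eq_mod flip: zmul_diff_left)
  then have "zmul (k mod int r) g \<in> H"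
    using k H zmul_in_subgroup[OF H r(2), of "k div int r"]
    by (simp add: zmul_mult int_module.subspace_diff)
  moreover have "zmul (k mod int r) g \<notin> H" if "0 < k mod int r"
  proof -
    have "nat (k mod int r) < r" using r that by (simp only: nat_less_iff pos_mod_bound of_nat_0_less_iff)
    then have "zmul (int (nat (k mod int r))) g \<notin> H" using that by (intro least) linarith+
    moreover have "int (nat (k mod int r)) = k mod int r" using that by linarith
    ultimately show ?thesis by metis
  qed
  moreover have "0 \<le> k mod int r" using r by simp
  ultimately have "k mod int r = 0" by linarith
  then have k2: "k = int r * (k div int r)" using kr by (simp add: mult.commute)
  have "x (zmul k g) = x (zmul (k div int r) (zmul (int r) g))"
    using k2 by (simp add: zmul_mult mult.commute)
  also have "\<dots> = (z ^ r) powi (k div int r)" using cstar_hom_on_zmul[OF x r(2)] z by simp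
  also have "\<dots> = z powi k" by (subst (2) k2) (simp add: power_int_mult)
  finally show ?thesis .
qed

text \<open>Divisibility of the target: if \<open>g\<close> has finite order \<open>r\<close> modulo
  \<open>H\<close>, an \<open>r\<close>-th root of the value at \<open>zmul (int r) g\<close>
  serves; if the order is infinite, only \<open>k = 0\<close> has to be checked.\<close>

lemma cstar_extension_value:
  assumes x: "cstar_hom_on H x"
  shows "\<exists>z. z \<noteq> 0 \<and> (\<forall>k. zmul k g \<in> H \<longrightarrow> x (zmul k g) = z powi k)"
proof (cases "\<exists>r>0. zmul (int r) g \<in> H")
  case True
  define r where "r = (LEAST r. r > 0 \<and> zmul (int r) g \<in> H)"
  have r: "r > 0" "zmul (int r) g \<in> H" using LeastI_ex[OF True] by (auto simp: r_def)
  have least: "zmul (int d) g \<notin> H" if "0 < d" "d < r" for d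
    using not_less_Least[of d "\<lambda>r. r > 0 \<and> zmul (int r) g \<in> H"] that by (auto simp: r_def)
  have H: "int_module.subspace H" using x by (simp add: cstar_hom_on_def)
  have nz: "x (zmul (int r) g) \<noteq> 0" using x r unfolding cstar_hom_on_def by blast
  define z where "z = exp (Ln (x (zmul (int r) g)) / of_nat r)"
  have "z ^ r = x (zmul (int r) g)"
    using r nz by (simp add: z_def flip: exp_of_nat_mult)
  then show ?thesis using root_compat[OF H r least x] by (intro exI[of _ z]) (auto simp: z_def)
next
  case False
  have "k = 0" if "zmul k g \<in> H" for k
  proof (rule ccontr)
    assume "k \<noteq> 0"
    moreover have "zmul (- k) g \<in> H"
      using that x zmul_in_subgroup[of H "zmul k g" "-1"] by (simp add: cstar_hom_on_def zmul_mult)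
    ultimately show False using that False
      by (metis linorder_neqE_linordered_idom neg_0_less_iff_less of_nat_0_less_iff pos_int_cases)
  qed
  then show ?thesis using cstar_hom_on_0[OF x] by (intro exI[of _ 1]) (use \<open>\<And>k. zmul k g \<in> H \<Longrightarrow> k = 0\<close> in fastforce)
qed

text \<open>Zorn's lemma on graphs of extensions, ordered by inclusion; a maximal one has full
  domain because \<open>cstar_hom_extend_one\<close> would enlarge any other.\<close>

lemma cstar_hom_extend:
  assumes x: "cstar_hom_on H x"
  shows "\<exists>y. cstar_hom_on UNIV y \<and> (\<forall>h\<in>H. y h = x h)"
proof -
  define graph :: "'a set \<Rightarrow> ('a \<Rightarrow> complex) \<Rightarrow> ('a \<times> complex) set"
    where "graph K y = {(h, y h) | h. h \<in> K}" for K y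
  define \<A> where "\<A> = {graph K y | K y. cstar_hom_on K y \<and> graph H x \<subseteq> graph K y}"
  have gr: "(h, v) \<in> graph K y \<longleftrightarrow> h \<in> K \<and> v = y h" for h v K y
    by (auto simp: graph_def)
  have "\<Union>\<C> \<in> \<A>" if ne: "\<C> \<noteq> {}" and ch: "subset.chain \<A> \<C>" for \<C>
  proof -
    have CA: "\<C> \<subseteq> \<A>" using ch by (auto simp: subset.chain_def)
    have elem: "\<exists>K y. S = graph K y \<and> cstar_hom_on K y \<and> graph H x \<subseteq> S" if "S \<in> \<C>" for S
      using CA that unfolding \<A>_def by blast
    \<comment> \<open>The homomorphism conditions involve at most two points at a time, so it is
      enough that any two points of the union lie on one graph of the chain.\<close>
    have common: "\<exists>K y. graph K y \<in> \<C> \<and> cstar_hom_on K y \<and> (g, v) \<in> graph K y \<and> (h, w) \<in> graph K y"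
      if gv: "(g, v) \<in> \<Union>\<C>" and hw: "(h, w) \<in> \<Union>\<C>" for g v h w
    proof -
      from gv hw obtain S T where ST: "S \<in> \<C>" "T \<in> \<C>" "(g, v) \<in> S" "(h, w) \<in> T" by blast
      then have "S \<subseteq> T \<or> T \<subseteq> S" using ch by (auto simp: subset.chain_def)
      with ST obtain U where "U \<in> \<C>" "(g, v) \<in> U" "(h, w) \<in> U" by blast
      with elem[of U] show ?thesis by blast
    qed
    define K where "K = fst ` \<Union>\<C>"
    define y where "y g = (THE v. (g, v) \<in> \<Union>\<C>)" for g
    have y: "y g = v" if "(g, v) \<in> \<Union>\<C>" for g v
      unfolding y_def
    proof (rule the_equality)
      show "(g, v) \<in> \<Union>\<C>" by (rule that)
    next
      fix w assume "(g, w) \<in> \<Union>\<C>"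
      from common[OF this that] show "w = v" by (auto simp: gr)
    qed
    have K: "(g, y g) \<in> \<Union>\<C>" if "g \<in> K" for g
    proof -
      from that obtain v where "(g, v) \<in> \<Union>\<C>" unfolding K_def by force
      with y show ?thesis by metis
    qed
    have KI: "g \<in> K" if "(g, v) \<in> \<Union>\<C>" for g v
      unfolding K_def using that by (force intro: image_eqI[where x = "(g, v)"])
    have "(g, v) \<in> \<Union>\<C> \<longleftrightarrow> (g, v) \<in> graph K y" for g v
      unfolding gr using K KI y by metis
    then have U: "\<Union>\<C> = graph K y" by (intro set_eqI) (metis surj_pair)
    have "cstar_hom_on K y"
      unfolding cstar_hom_on_def int_module.subspace_def
    proof (intro conjI ballI allI)
      from ne obtain S where "S \<in> \<C>" by blast
      with elem obtain L z where L: "graph L z \<in> \<C>" "cstar_hom_on L z" by metis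
      then have "0 \<in> L" by (auto simp: cstar_hom_on_def int_module.subspace_0)
      then have "(0, z 0) \<in> \<Union>\<C>" using L gr by blast
      then show "0 \<in> K" by (rule KI)
    next
      fix g h assume "g \<in> K" "h \<in> K"
      from common[OF K[OF this(1)] K[OF this(2)]] obtain L z
        where L: "graph L z \<in> \<C>" "cstar_hom_on L z" "g \<in> L" "y g = z g" "h \<in> L" "y h = z h"
        by (auto simp: gr)
      then have "g + h \<in> L" "z (g + h) = z g * z h"
        by (auto simp: cstar_hom_on_def int_module.subspace_add)
      then have gh: "(g + h, y g * y h) \<in> \<Union>\<C>" using L gr by (metis UnionI)
      from gh show "g + h \<in> K" by (rule KI)
      from gh show "y (g + h) = y g * y h" by (rule y)
    next
      fix k g assume "g \<in> K"
      from common[OF K[OF this] K[OF this]] obtain L z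
        where L: "graph L z \<in> \<C>" "cstar_hom_on L z" "g \<in> L" "y g = z g"
        by (auto simp: gr)
      then have "zmul k g \<in> L" by (auto simp: cstar_hom_on_def zmul_in_subgroup)
      then have "(zmul k g, z (zmul k g)) \<in> \<Union>\<C>" using L gr by blast
      then show "zmul k g \<in> K" by (rule KI)
    next
      fix g assume "g \<in> K"
      from common[OF K[OF this] K[OF this]] obtain L z
        where L: "cstar_hom_on L z" "g \<in> L" "y g = z g"
        by (auto simp: gr)
      then show "y g \<noteq> 0" by (auto simp: cstar_hom_on_def)
    qed
    moreover have "graph H x \<subseteq> \<Union>\<C>" using ne elem by blast
    ultimately show ?thesis unfolding \<A>_def U by blast
  qed
  moreover have "\<A> \<noteq> {}" unfolding \<A>_def using x by blast
  ultimately obtain M where M: "M \<in> \<A>" "\<And>X. X \<in> \<A> \<Longrightarrow> M \<subseteq> X \<Longrightarrow> X = M"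
    using subset_Zorn_nonempty[of \<A>] by metis
  then obtain K y where K: "M = graph K y" "cstar_hom_on K y" "graph H x \<subseteq> graph K y"
    unfolding \<A>_def by blast
  have "g \<in> K" for g
  proof -
    obtain z where "z \<noteq> 0" "\<forall>k. zmul k g \<in> K \<longrightarrow> y (zmul k g) = z powi k"
      using cstar_extension_value[OF K(2), of g] by blast
    then obtain K' y' where K': "cstar_hom_on K' y'" "K \<subseteq> K'" "g \<in> K'" "\<forall>h\<in>K. y' h = y h"
      using cstar_hom_extend_one[OF K(2), of z g] by blast
    then have "graph K y \<subseteq> graph K' y'" by (auto simp: gr)
    moreover from this have "graph K' y' \<in> \<A>" unfolding \<A>_def using K' K by blast
    ultimately have "graph K' y' = graph K y" using M K by blast
    then show ?thesis using K'(3) gr by metis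
  qed
  then have "K = UNIV" by blast
  moreover have "y h = x h" if "h \<in> H" for h
    using K(3) that by (auto simp: gr subset_iff)
  ultimately show ?thesis using K by blast
qed

text \<open>Radial projection to the circle is multiplicative and fixes unimodular values, so it
  turns extensions into characters.\<close>

lemma dual_group_of_cstar_hom:
  assumes "cstar_hom_on UNIV x" shows "(\<lambda>g. sgn (x g)) \<in> dual_group"
proof -
  have "x g \<noteq> 0" "x (g + h) = x g * x h" for g h
    using assms unfolding cstar_hom_on_def by blast+
  then show ?thesis by (simp add: dual_group_def norm_sgn sgn_mult)
qed

lemma cstar_hom_on_dual:
  assumes "x \<in> dual_group" "int_module.subspace H" shows "cstar_hom_on H x"
proof -
  have "norm (x g) = 1" "x (g + h) = x g * x h" for g h
    using assms(1) by (simp_all add: dual_group_def)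
  then have "x g \<noteq> 0" "x (g + h) = x g * x h" for g h using norm_zero zero_neq_one by metis+
  then show ?thesis using assms(2) by (simp add: cstar_hom_on_def)
qed

lemma dual_group_extend:
  assumes "cstar_hom_on H x" "\<And>h. h \<in> H \<Longrightarrow> norm (x h) = 1"
  shows "\<exists>y\<in>dual_group. \<forall>h\<in>H. y h = x h"
proof -
  obtain y where y: "cstar_hom_on UNIV y" "\<forall>h\<in>H. y h = x h"
    using cstar_hom_extend[OF assms(1)] by blast
  then show ?thesis using assms(2) dual_group_of_cstar_hom[OF y(1)]
    by (intro bexI[of _ "\<lambda>g. sgn (y g)"]) (auto simp: sgn_eq)
qed

text \<open>Adjoin \<open>g\<close>, extend to the whole group, then project radially; the
  projection alters neither \<open>z\<close> nor the values on \<open>H\<close>.\<close>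

lemma dual_group_extend_value:
  assumes x: "x \<in> dual_group" and H: "int_module.subspace H" and z: "norm z = 1"
    and compat: "\<And>k. zmul k g \<in> H \<Longrightarrow> x (zmul k g) = z powi k"
  shows "\<exists>y\<in>dual_group. (\<forall>h\<in>H. y h = x h) \<and> y g = z"
proof -
  obtain H' y where y: "cstar_hom_on H' y" "H \<subseteq> H'" "g \<in> H'" "\<forall>h\<in>H. y h = x h" "y g = z"
    using cstar_hom_extend_one[OF cstar_hom_on_dual[OF x H] _ compat] z by fastforce
  obtain w where w: "cstar_hom_on UNIV w" "\<forall>h\<in>H'. w h = y h"
    using cstar_hom_extend[OF y(1)] by blast
  have "sgn (w h) = x h" if "h \<in> H" for h
    using that w y x by (auto simp: dual_group_def sgn_eq subset_iff)
  moreover have "sgn (w g) = z" using w y z by (simp add: sgn_eq)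
  ultimately show ?thesis using dual_group_of_cstar_hom[OF w(1)]
    by (intro bexI[of _ "\<lambda>g. sgn (w g)"]) auto
qed

text \<open>Real-valued homomorphisms arise as the logarithm of the modulus of \<open>\<complex>\<^sup>*\<close>-valued ones.\<close>

lemma infinite_generated_unbounded_hom:
  assumes "finite S" "infinite A" "A \<subseteq> generated S"
  shows "\<exists>p :: 'a::ab_group_add \<Rightarrow> real. (\<forall>g h. p (g + h) = p g + p h) \<and> \<not> bounded (p ` A)"
  using assms
proof (induction S arbitrary: A rule: finite_induct)
  case empty
  then have "finite A" by (auto intro: finite_subset)
  with empty show ?case by blast
next
  case (insert s S)
  let ?H = "generated S"
  have split: "\<exists>k. a - zmul k s \<in> ?H" if "a \<in> A" for a
    using insert.prems(2) that by (auto simp: int_module.span_insert)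
  \<comment> \<open>If finitely many coefficients of \<open>s\<close> suffice, one of them occurs on
    an infinite subset of \<open>A\<close>. Subtracting that multiple of \<open>s\<close> moves the
    subset into \<open>generated S\<close>, and unboundedness carries back to
    \<open>A\<close>.\<close>
  have reduce: ?case if K: "finite K" "\<And>a. a \<in> A \<Longrightarrow> \<exists>k\<in>K. a - zmul k s \<in> ?H" for K
  proof -
    have "\<exists>k\<in>K. infinite {a \<in> A. a - zmul k s \<in> ?H}"
      by (rule pigeonhole_infinite_rel) (use insert.prems K in auto)
    then obtain k where k: "infinite {a \<in> A. a - zmul k s \<in> ?H}" by blast
    let ?B = "(\<lambda>a. a - zmul k s) ` {a \<in> A. a - zmul k s \<in> ?H}"
    have "infinite ?B" using k by (subst finite_image_iff) (auto intro: inj_onI)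
    then obtain p :: "'a \<Rightarrow> real" where p: "\<forall>g h. p (g + h) = p g + p h" "\<not> bounded (p ` ?B)"
      using insert.IH[of ?B] by blast
    have "\<not> bounded (p ` A)"
    proof
      assume "bounded (p ` A)"
      then obtain C where C: "\<And>a. a \<in> A \<Longrightarrow> \<bar>p a\<bar> \<le> C" by (auto simp: bounded_iff)
      have "\<bar>p (a - zmul k s)\<bar> \<le> C + \<bar>p (zmul k s)\<bar>" if "a \<in> A" for a
        using C[OF that] p(1)[rule_format, of "a - zmul k s" "zmul k s"] by simp
      then have "bounded (p ` ?B)" unfolding bounded_iff by auto
      with p show False by blast
    qed
    with p show ?thesis by blast
  qed
  show ?case
  proof (cases "\<exists>r>0. zmul (int r) s \<in> ?H")
    case True
    then obtain r where r: "r > 0" "zmul (int r) s \<in> ?H" by blast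
    \<comment> \<open>Coefficients of \<open>s\<close> matter only modulo \<open>r\<close>.\<close>
    show ?thesis
    proof (rule reduce[of "{0..<int r}"])
      fix a assume "a \<in> A"
      then obtain k where k: "a - zmul k s \<in> ?H" using split by blast
      have eq: "a - zmul (k mod int r) s = (a - zmul k s) + zmul (k div int r * int r) s"
        by (simp only: zmul_diff_left flip: minus_div_mult_eq_mod) (simp add: algebra_simps)
      moreover have "zmul (k div int r * int r) s \<in> ?H"
        using zmul_in_subgroup[OF _ r(2), of "k div int r"] by (simp add: zmul_mult)
      ultimately have "a - zmul (k mod int r) s \<in> ?H" unfolding eq using k by (intro int_module.span_add)
      then show "\<exists>k\<in>{0..<int r}. a - zmul k s \<in> ?H" using r by (intro bexI) auto
    qed auto
  next
    case False
    have ind: "k = 0" if "zmul k s \<in> ?H" for k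
    proof (rule ccontr)
      assume "k \<noteq> 0"
      moreover have "zmul (- k) s \<in> ?H" using that by (simp add: int_module.span_neg)
      ultimately show False using that False
        by (metis linorder_neqE_linordered_idom neg_0_less_iff_less of_nat_0_less_iff pos_int_cases)
    qed
    \<comment> \<open>No nonzero multiple of \<open>s\<close> lies in \<open>?H\<close>, so the
      trivial homomorphism extends with value \<open>exp 1\<close> at \<open>s\<close>; the
      logarithm of its modulus reads off the coefficient of \<open>s\<close>.\<close>
    have "cstar_hom_on ?H (\<lambda>_. 1)" by (auto simp: cstar_hom_on_def)
    then obtain H' y where y: "cstar_hom_on H' y" "?H \<subseteq> H'" "s \<in> H'" "\<forall>h\<in>?H. y h = 1"
        "y s = exp 1"
      using cstar_hom_extend_one[of ?H "\<lambda>_. 1" "exp 1" s] ind by fastforce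
    obtain w where w: "cstar_hom_on UNIV w" "\<forall>h\<in>H'. w h = y h"
      using cstar_hom_extend[OF y(1)] by blast
    define p where "p g = ln (norm (w g))" for g
    have p: "p (g + h) = p g + p h" for g h
      using w(1) by (simp add: cstar_hom_on_def p_def norm_mult ln_mult)
    have pk: "p a = of_int k" if "a - zmul k s \<in> ?H" for a k
    proof -
      have "w (a - zmul k s) = 1" using that w y by auto
      then have "p (a - zmul k s) = 0" by (simp add: p_def)
      moreover have "w s = exp 1" using w y by auto
      then have "w (zmul k s) = exp 1 powi k" using cstar_hom_on_zmul[OF w(1), of s k] by simp
      then have "p (zmul k s) = of_int k" by (simp add: p_def exp_power_int)
      ultimately show ?thesis using p[of "a - zmul k s" "zmul k s"] by simp
    qed
    show ?thesis
    proof (cases "bounded (p ` A)")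
      \<comment> \<open>A bound for \<open>p\<close> on \<open>A\<close> bounds the coefficients, so
        \<open>reduce\<close> applies; otherwise \<open>p\<close> itself is the homomorphism
        sought.\<close>
      case True
      then obtain C where C: "\<And>a. a \<in> A \<Longrightarrow> \<bar>p a\<bar> \<le> C" by (auto simp: bounded_iff)
      show ?thesis
      proof (rule reduce[of "{-\<lceil>C\<rceil>..\<lceil>C\<rceil>}"])
        fix a assume a: "a \<in> A"
        then obtain k where k: "a - zmul k s \<in> ?H" using split by blast
        then have "\<bar>of_int k\<bar> \<le> C" using C[OF a] pk[OF k] by simp
        then have "k \<in> {-\<lceil>C\<rceil>..\<lceil>C\<rceil>}" by (simp add: abs_le_iff) linarith
        with k show "\<exists>k\<in>{-\<lceil>C\<rceil>..\<lceil>C\<rceil>}. a - zmul k s \<in> ?H" by blast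
      qed auto
    next
      case False
      with p show ?thesis by blast
    qed
  qed
qed

section \<open>Successive prescription of character values\<close>

text \<open>Consistent values along an increasing chain define a homomorphism on the union, which is
  again a subgroup, and this extends to the whole group.\<close>

lemma dual_group_extend_union:
  fixes \<Lambda> :: "nat \<Rightarrow> 'a::ab_group_add set"
  assumes sub: "\<And>n. int_module.subspace (\<Lambda> n)" and mono: "\<And>n. \<Lambda> n \<subseteq> \<Lambda> (Suc n)"
    and x: "\<And>n. x n \<in> dual_group" and ext: "\<And>n g. g \<in> \<Lambda> n \<Longrightarrow> x (Suc n) g = x n g"
  shows "\<exists>y\<in>dual_group. \<forall>n. \<forall>g\<in>\<Lambda> n. y g = x n g"
proof -
  have up: "\<Lambda> m \<subseteq> \<Lambda> n" if "m \<le> n" for m n using lift_Suc_mono_le[of \<Lambda>, OF mono that] .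
  have agree: "x n g = x m g" if "m \<le> n" "g \<in> \<Lambda> m" for m n g
    using that(1)
  proof (induction rule: dec_induct)
    case (step k) then show ?case using ext[of g k] up[of m k] that(2) by auto
  qed simp
  define y where "y g = x (LEAST n. g \<in> \<Lambda> n) g" for g
  have y: "y g = x n g" if "g \<in> \<Lambda> n" for g n
    unfolding y_def using agree[of "LEAST n. g \<in> \<Lambda> n" n g, symmetric]
    LeastI[of "\<lambda>n. g \<in> \<Lambda> n", OF that] Least_le[of "\<lambda>n. g \<in> \<Lambda> n", OF that] by blast
  let ?H = "\<Union>n. \<Lambda> n"
  have common: "\<exists>n. g \<in> \<Lambda> n \<and> h \<in> \<Lambda> n" if "g \<in> ?H" "h \<in> ?H" for g h
  proof -
    from that obtain m n where "g \<in> \<Lambda> m" "h \<in> \<Lambda> n" by blast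
    then show ?thesis using up[of m "max m n"] up[of n "max m n"] by auto
  qed
  have "cstar_hom_on ?H y"
    unfolding cstar_hom_on_def int_module.subspace_def
  proof (intro conjI ballI allI)
    show "0 \<in> ?H" using int_module.subspace_0[OF sub] by blast
  next
    fix g h assume "g \<in> ?H" "h \<in> ?H"
    then obtain n where n: "g \<in> \<Lambda> n" "h \<in> \<Lambda> n" using common by blast
    then have gh: "g + h \<in> \<Lambda> n" by (rule int_module.subspace_add[OF sub])
    then show "g + h \<in> ?H" by blast
    show "y (g + h) = y g * y h" using y n gh x[of n] by (simp add: dual_group_def)
  next
    fix k g assume "g \<in> ?H"
    then show "zmul k g \<in> ?H" using zmul_in_subgroup[OF sub] by blast
  next
    fix g assume "g \<in> ?H"
    then obtain n where "g \<in> \<Lambda> n" by blast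
    then have "norm (y g) = 1" using y x[of n] by (simp add: dual_group_def)
    then show "y g \<noteq> 0" by auto
  qed
  moreover have "norm (y h) = 1" if "h \<in> ?H" for h using that y x by (auto simp: dual_group_def)
  ultimately obtain w where "w \<in> dual_group" "\<forall>h\<in>?H. w h = y h" using dual_group_extend by blast
  with y show ?thesis by (metis UN_I UNIV_I)
qed

text \<open>Stage \<open>n\<close> secures \<open>R n\<close> without changing the values on
  \<open>\<Lambda> n\<close>, hence without spoiling earlier requirements. As \<open>c\<close> lies
  in every \<open>\<Lambda> n\<close>, the condition \<open>x c = 1\<close> persists; it serves the
  case of a constant double, and \<open>c = 0\<close> is taken in the other application.\<close>

lemma dual_group_interpolate:
  fixes \<Lambda> :: "nat \<Rightarrow> 'a::ab_group_add set"
  assumes sub: "\<And>n. int_module.subspace (\<Lambda> n)" and mono: "\<And>n. \<Lambda> n \<subseteq> \<Lambda> (Suc n)"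
    and e: "\<And>n. e n \<in> \<Lambda> (Suc n)" and c: "\<And>n. c \<in> \<Lambda> n"
    and step: "\<And>n x. x \<in> dual_group \<Longrightarrow> x c = 1 \<Longrightarrow>
      \<exists>y\<in>dual_group. (\<forall>g\<in>\<Lambda> n. y g = x g) \<and> R n (y (e n))"
  shows "\<exists>x\<in>dual_group. \<forall>n. R n (x (e n))"
proof -
  have "\<exists>X. \<forall>n. (X n \<in> dual_group \<and> X n c = 1) \<and>
      ((\<forall>g\<in>\<Lambda> n. X (Suc n) g = X n g) \<and> R n (X (Suc n) (e n)))"
  proof (rule dependent_nat_choice)
    show "\<exists>x. x \<in> dual_group \<and> x c = 1" by (intro exI[of _ "\<lambda>_. 1"]) (auto simp: dual_group_def)
  next
    fix x n assume "x \<in> dual_group \<and> x c = 1"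
    then show "\<exists>y. (y \<in> dual_group \<and> y c = 1) \<and> ((\<forall>g\<in>\<Lambda> n. y g = x g) \<and> R n (y (e n)))"
      using step[of x n] c[of n] by metis
  qed
  then obtain X where X: "\<And>n. X n \<in> dual_group" "\<And>n g. g \<in> \<Lambda> n \<Longrightarrow> X (Suc n) g = X n g"
      "\<And>n. R n (X (Suc n) (e n))" by blast
  obtain y where y: "y \<in> dual_group" "\<forall>n. \<forall>g\<in>\<Lambda> n. y g = X n g"
    using dual_group_extend_union[of \<Lambda> X, OF sub mono X(1,2)] by blast
  have "R n (y (e n))" for n using X(3)[of n] y(2) e[of n] by auto
  with y show ?thesis by blast
qed

lemma unit_eq_cis:
  assumes "norm w = 1" shows "\<exists>\<theta>. cis \<theta> = w \<and> \<bar>\<theta>\<bar> \<le> pi"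
proof (intro exI conjI)
  have "w \<noteq> 0" using assms by auto
  then show "cis (Arg w) = w" using cis_Arg[of w] assms by (simp add: sgn_eq)
  show "\<bar>Arg w\<bar> \<le> pi" using Arg_bounded[of w] by linarith
qed

text \<open>The cube roots of unity give \<open>\<pi>/3 \<le> 6/5\<close>; any constant below \<open>\<surd>2\<close> would do.\<close>

lemma circle_root_near:
  assumes t: "norm t = 1" and w: "norm (w :: complex) = 1" and r: "r \<ge> 3"
  shows "\<exists>z. norm z = 1 \<and> z ^ r = w \<and> norm (t - z) \<le> 6/5"
proof -
  \<comment> \<open>The angle between \<open>t ^ r\<close> and \<open>w\<close> is at most
    \<open>pi\<close>, so turning \<open>t\<close> through an \<open>r\<close>-th of it reaches a
    root at small distance.\<close>
  have "norm (w / t ^ r) = 1" using t w by (simp add: norm_divide norm_power)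
  then obtain \<theta> where \<theta>: "cis \<theta> = w / t ^ r" "\<bar>\<theta>\<bar> \<le> pi" using unit_eq_cis by blast
  define z where "z = t * cis (\<theta> / r)"
  have "cis (\<theta> / r) ^ r = cis (r * (\<theta> / r))" by (rule Complex.DeMoivre)
  then have "z ^ r = w" using r \<theta> t by (auto simp: z_def power_mult_distrib)
  moreover have "norm z = 1" using t by (simp add: z_def norm_mult)
  moreover have "norm (t - z) = norm (1 - cis (\<theta> / r))"
    using t by (metis (no_types, opaque_lifting) z_def mult.right_neutral norm_mult right_diff_distrib mult_1)
  moreover have "norm (1 - cis (\<theta> / r)) \<le> \<bar>\<theta> / r\<bar>"
    using dist_exp_i_1[of "\<theta> / r"] abs_sin_x_le_abs_x[of "\<theta> / r / 2"]
    by (simp add: cis_conv_exp norm_minus_commute)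
  moreover have "\<bar>\<theta> / r\<bar> \<le> pi / 3" unfolding abs_divide using \<theta>(2) r by (intro frac_le) auto
  moreover have "pi / 3 \<le> 6/5" using pi_less_4 pi_approx by simp
  ultimately show ?thesis by (intro exI[of _ z]) auto
qed

text \<open>The two exclusions say that \<open>g\<close> has order at least three or infinite modulo
  \<open>H\<close>. A finite order admits a root supplied by \<open>circle_root_near\<close>; an
  infinite one admits \<open>t\<close> itself.\<close>

lemma dual_group_extend_near:
  assumes x: "x \<in> dual_group" and H: "int_module.subspace H" and t: "norm t = 1"
    and g: "g \<notin> H" "g + g \<notin> H"
  shows "\<exists>y\<in>dual_group. (\<forall>h\<in>H. y h = x h) \<and> norm (t - y g) \<le> 6/5"
proof (cases "\<exists>r>0. zmul (int r) g \<in> H")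
  case True
  define r where "r = (LEAST r. r > 0 \<and> zmul (int r) g \<in> H)"
  have r: "r > 0" "zmul (int r) g \<in> H" using LeastI_ex[OF True] by (auto simp: r_def)
  have least: "zmul (int d) g \<notin> H" if "0 < d" "d < r" for d
    using not_less_Least[of d "\<lambda>r. r > 0 \<and> zmul (int r) g \<in> H"] that by (auto simp: r_def)
  have "zmul 2 g = g + g" using zmul_add[of 1 1 g] by simp
  then have "r \<noteq> 1" "r \<noteq> 2" using r g by auto
  with r have "r \<ge> 3" by simp
  moreover have "norm (x (zmul (int r) g)) = 1" using x by (simp add: dual_group_def)
  ultimately obtain z where z: "norm z = 1" "z ^ r = x (zmul (int r) g)" "norm (t - z) \<le> 6/5"
    using circle_root_near[OF t] by blast
  show ?thesis
    using dual_group_extend_value[OF x H z(1) root_compat[OF H r least cstar_hom_on_dual[OF x H] z(2)]] z(3)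
    by blast
next
  case False
  have "k = 0" if "zmul k g \<in> H" for k
  proof (rule ccontr)
    assume "k \<noteq> 0"
    moreover have "zmul (- k) g \<in> H" using that H int_module.subspace_neg by fastforce
    ultimately show False using that False
      by (metis linorder_neqE_linordered_idom neg_0_less_iff_less of_nat_0_less_iff pos_int_cases)
  qed
  then have "x (zmul k g) = t powi k" if "zmul k g \<in> H" for k
    using that cstar_hom_on_0[OF cstar_hom_on_dual[OF x H]] by fastforce
  from dual_group_extend_value[OF x H t this] show ?thesis by force
qed

text \<open>Here \<open>g\<close> has order exactly two modulo \<open>H\<close>, so the admissible
  values at \<open>g\<close> are the square roots of \<open>x (g + g) = 1\<close>.\<close>

lemma dual_group_extend_sign:
  assumes x: "x \<in> dual_group" and H: "int_module.subspace H" and s: "s = 1 \<or> s = - 1"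
    and g: "g \<notin> H" "g + g \<in> H" "x (g + g) = 1"
  shows "\<exists>y\<in>dual_group. (\<forall>h\<in>H. y h = x h) \<and> y g = s"
proof -
  have g2: "zmul (int 2) g = g + g" using zmul_add[of 1 1 g] by simp
  have r: "(2::nat) > 0" "zmul (int 2) g \<in> H" using g g2 by auto
  have least: "zmul (int d) g \<notin> H" if "0 < d" "d < 2" for d
  proof -
    have "d = 1" using that by simp
    then show ?thesis using g by simp
  qed
  have z: "norm s = 1" "s ^ 2 = x (zmul (int 2) g)" using s g g2 by auto
  show ?thesis
    using dual_group_extend_value[OF x H z(1) root_compat[OF H r least cstar_hom_on_dual[OF x H] z(2)]]
    by blast
qed

section \<open>Interpolation by discrete measures\<close>

text \<open>\<open>sums\<close> in place of an equation between infinite sums lets combinations be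
  formed termwise; absolute summability of the coefficients makes the two versions agree.\<close>

definition discrete_transform_on :: "'a::ab_group_add set \<Rightarrow> ('a \<Rightarrow> complex) \<Rightarrow> bool" where
  "discrete_transform_on E \<phi> \<longleftrightarrow> (\<exists>(a :: nat \<Rightarrow> complex) x. summable (\<lambda>k. norm (a k)) \<and>
     (\<forall>k. x k \<in> dual_group) \<and> (\<forall>\<gamma>\<in>E. (\<lambda>k. a k * cnj (x k \<gamma>)) sums \<phi> \<gamma>))"

lemma summable_discrete_transform:
  assumes "summable (\<lambda>k. norm (a k :: complex))" "\<And>k. x k \<in> dual_group"
  shows "summable (\<lambda>k. a k * cnj (x k \<gamma>))"
proof (rule summable_norm_cancel)
  have "norm (x k \<gamma>) = 1" for k using assms(2) by (simp add: dual_group_def)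
  then show "summable (\<lambda>k. norm (a k * cnj (x k \<gamma>)))" using assms(1) by (simp add: norm_mult)
qed

lemma I0_set_iff_discrete_transform_on:
  "I0_set E \<longleftrightarrow> (\<forall>\<phi>. bounded (\<phi> ` E) \<longrightarrow> discrete_transform_on E \<phi>)"
proof -
  have "(\<Sum>k. a k * cnj (x k \<gamma>)) = v \<longleftrightarrow> (\<lambda>k. a k * cnj (x k \<gamma>)) sums v"
    if "summable (\<lambda>k. norm (a k))" "\<forall>k. x k \<in> dual_group"
    for a :: "nat \<Rightarrow> complex" and x :: "nat \<Rightarrow> 'a \<Rightarrow> complex" and \<gamma> v
    using summable_discrete_transform[of a x \<gamma>] that by (simp add: sums_iff)
  then have "(\<exists>(a :: nat \<Rightarrow> complex) x. summable (\<lambda>k. norm (a k)) \<and> (\<forall>k. x k \<in> dual_group) \<and>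
      (\<forall>\<gamma>\<in>E. (\<Sum>k. a k * cnj (x k \<gamma>)) = \<phi> \<gamma>)) \<longleftrightarrow> discrete_transform_on E \<phi>" for \<phi>
    unfolding discrete_transform_on_def by (intro ex_cong1 conj_cong ball_cong) auto
  then show ?thesis unfolding I0_set_iff_series by presburger
qed

lemma discrete_transform_on_cmult:
  assumes "discrete_transform_on E \<phi>" shows "discrete_transform_on E (\<lambda>\<gamma>. c * \<phi> \<gamma>)"
proof -
  obtain a :: "nat \<Rightarrow> complex" and x where a: "summable (\<lambda>k. norm (a k))" "\<forall>k. x k \<in> dual_group"
    "\<forall>\<gamma>\<in>E. (\<lambda>k. a k * cnj (x k \<gamma>)) sums \<phi> \<gamma>"
    using assms unfolding discrete_transform_on_def by blast
  then show ?thesis unfolding discrete_transform_on_def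
    by (intro exI[of _ "\<lambda>k. c * a k"] exI[of _ x])
      (auto simp: norm_mult mult.assoc intro: summable_mult sums_mult)
qed

lemma sums_interleave:
  fixes f g :: "nat \<Rightarrow> complex"
  assumes "g sums x" "f sums y"
  shows "(\<lambda>n. if even n then f (n div 2) else g ((n - 1) div 2)) sums (x + y)"
proof -
  have fg: "(\<lambda>n. Re (g n)) sums Re x" "(\<lambda>n. Re (f n)) sums Re y"
    "(\<lambda>n. Im (g n)) sums Im x" "(\<lambda>n. Im (f n)) sums Im y"
    using assms by (simp_all add: sums_complex_iff)
  show ?thesis
    unfolding sums_complex_iff if_distrib[of Re] if_distrib[of Im] plus_complex.sel
    by (intro conjI sums_if fg)
qed

text \<open>Measures are added by merging their lists of atoms: even positions carry the second, odd
  positions the first.\<close>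

lemma discrete_transform_on_add:
  assumes "discrete_transform_on E \<phi>" "discrete_transform_on E \<psi>"
  shows "discrete_transform_on E (\<lambda>\<gamma>. \<phi> \<gamma> + \<psi> \<gamma>)"
proof -
  obtain a :: "nat \<Rightarrow> complex" and x where a: "summable (\<lambda>k. norm (a k))" "\<forall>k. x k \<in> dual_group"
    "\<forall>\<gamma>\<in>E. (\<lambda>k. a k * cnj (x k \<gamma>)) sums \<phi> \<gamma>"
    using assms(1) unfolding discrete_transform_on_def by blast
  obtain b :: "nat \<Rightarrow> complex" and y where b: "summable (\<lambda>k. norm (b k))" "\<forall>k. y k \<in> dual_group"
    "\<forall>\<gamma>\<in>E. (\<lambda>k. b k * cnj (y k \<gamma>)) sums \<psi> \<gamma>"
    using assms(2) unfolding discrete_transform_on_def by blast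
  let ?c = "\<lambda>n. if even n then b (n div 2) else a ((n - 1) div 2)"
  let ?z = "\<lambda>n. if even n then y (n div 2) else x ((n - 1) div 2)"
  have "summable (\<lambda>n. norm (?c n))"
    using sums_if[OF summable_sums[OF a(1)] summable_sums[OF b(1)]]
    by (simp add: sums_iff if_distrib[of norm])
  moreover have "(\<lambda>n. ?c n * cnj (?z n \<gamma>)) sums (\<phi> \<gamma> + \<psi> \<gamma>)" if "\<gamma> \<in> E" for \<gamma>
  proof -
    have "(\<lambda>n. ?c n * cnj (?z n \<gamma>)) =
      (\<lambda>n. if even n then b (n div 2) * cnj (y (n div 2) \<gamma>)
           else a ((n - 1) div 2) * cnj (x ((n - 1) div 2) \<gamma>))" by auto
    then show ?thesis using sums_interleave[OF bspec[OF a(3) that] bspec[OF b(3) that]] by simp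
  qed
  ultimately show ?thesis unfolding discrete_transform_on_def
    using a(2) b(2) by (intro exI[of _ ?c] exI[of _ ?z]) auto
qed

text \<open>Geometric iteration: each step replaces \<open>\<phi>\<close> by its rescaled error \<open>(\<phi> - c x) / q\<close>.\<close>

lemma discrete_transform_on_iterate:
  assumes q: "0 < q" "q < 1"
    and bound: "\<And>\<phi> \<gamma>. \<phi> \<in> S \<Longrightarrow> \<gamma> \<in> E \<Longrightarrow> norm (\<phi> \<gamma>) \<le> 1"
    and step: "\<And>\<phi>. \<phi> \<in> S \<Longrightarrow> \<exists>x\<in>dual_group.
      (\<lambda>\<gamma>. (\<phi> \<gamma> - complex_of_real c * cnj (x \<gamma>)) / complex_of_real q) \<in> S"
    and \<phi>: "\<phi> \<in> S"
  shows "discrete_transform_on E \<phi>"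
proof -
  have "\<exists>\<Phi>. \<forall>n. (\<Phi> n \<in> S \<and> (n = 0 \<longrightarrow> \<Phi> n = \<phi>)) \<and> (\<exists>x\<in>dual_group.
    \<Phi> (Suc n) = (\<lambda>\<gamma>. (\<Phi> n \<gamma> - complex_of_real c * cnj (x \<gamma>)) / complex_of_real q))"
    by (rule dependent_nat_choice) (use \<phi> step in blast)+
  then obtain \<Phi> where S: "\<And>n. \<Phi> n \<in> S" and 0: "\<Phi> 0 = \<phi>"
    and ex: "\<forall>n. \<exists>x\<in>dual_group.
      \<Phi> (Suc n) = (\<lambda>\<gamma>. (\<Phi> n \<gamma> - complex_of_real c * cnj (x \<gamma>)) / complex_of_real q)"
    by blast
  obtain x where x: "\<And>n. x n \<in> dual_group"
      "\<And>n. \<Phi> (Suc n) = (\<lambda>\<gamma>. (\<Phi> n \<gamma> - complex_of_real c * cnj (x n \<gamma>)) / complex_of_real q)"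
    using ex by metis
  \<comment> \<open>Undoing \<open>n\<close> rescalings turns the coefficient \<open>c\<close> of
    stage \<open>n\<close> into \<open>c * q ^ n\<close>.\<close>
  define a where "a n = complex_of_real (c * q ^ n)" for n
  have sm: "summable (\<lambda>n. norm (a n))"
    using q by (simp add: a_def norm_mult norm_power summable_geometric summable_mult)
  \<comment> \<open>The sum telescopes, and the remainder vanishes in the limit because members of
    \<open>S\<close> are bounded by 1 on \<open>E\<close>.\<close>
  have partial: "(\<Sum>k<n. a k * cnj (x k \<gamma>)) = \<phi> \<gamma> - q ^ n * \<Phi> n \<gamma>" for n \<gamma>
  proof (induction n)
    case (Suc n)
    have step: "q ^ Suc n * \<Phi> (Suc n) \<gamma> = q ^ n * \<Phi> n \<gamma> - a n * cnj (x n \<gamma>)"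
      using q unfolding x(2) a_def by (simp add: field_simps)
    show ?case unfolding sum.lessThan_Suc Suc step by simp
  qed (simp add: 0)
  have "(\<lambda>k. a k * cnj (x k \<gamma>)) sums \<phi> \<gamma>" if "\<gamma> \<in> E" for \<gamma>
  proof -
    have "(\<lambda>n. q ^ n) \<longlonglongrightarrow> 0" using q by (simp add: LIMSEQ_realpow_zero)
    then have "(\<lambda>n. complex_of_real (q ^ n) * \<Phi> n \<gamma>) \<longlonglongrightarrow> 0"
    proof (rule Lim_null_comparison[rotated])
      show "\<forall>\<^sub>F n in sequentially. norm (complex_of_real (q ^ n) * \<Phi> n \<gamma>) \<le> q ^ n"
        using bound[OF S that] q by (auto simp: norm_mult norm_power intro: mult_left_le)
    qed
    from tendsto_diff[OF tendsto_const[of "\<phi> \<gamma>"] this]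
    show ?thesis unfolding sums_def partial by simp
  qed
  with sm x show ?thesis unfolding discrete_transform_on_def by blast
qed

section \<open>From approximation by characters to interpolation\<close>

lemma weak_Kronecker_mono: "weak_Kronecker \<delta> E \<Longrightarrow> \<delta> \<le> \<epsilon> \<Longrightarrow> weak_Kronecker \<epsilon> E"
  unfolding weak_Kronecker_def
proof (intro allI impI)
  fix \<phi> :: "'a \<Rightarrow> complex"
  assume *: "\<forall>\<phi> :: 'a \<Rightarrow> complex. (\<forall>\<gamma>\<in>E. norm (\<phi> \<gamma>) = 1) \<longrightarrow>
      (\<exists>x\<in>dual_group. \<forall>\<gamma>\<in>E. norm (\<phi> \<gamma> - x \<gamma>) \<le> \<delta>)" and "\<delta> \<le> \<epsilon>" "\<forall>\<gamma>\<in>E. norm (\<phi> \<gamma>) = 1"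
  from spec[OF *, of \<phi>] this(3) obtain x where "x \<in> dual_group" "\<forall>\<gamma>\<in>E. norm (\<phi> \<gamma> - x \<gamma>) \<le> \<delta>"
    by auto
  then show "\<exists>x\<in>dual_group. \<forall>\<gamma>\<in>E. norm (\<phi> \<gamma> - x \<gamma>) \<le> \<epsilon>"
    using \<open>\<delta> \<le> \<epsilon>\<close> by (intro bexI[of _ x]) auto
qed

text \<open>Expanding squares, the distance bound makes the inner product of \<open>u\<close> and
  \<open>w\<close> at least 7/25. The squared norm is then at most 43/50 + 1/16 = 369/400, which is
  below the square of 97/100, for every radius \<open>r\<close> in the unit interval.\<close>

lemma near_scaled_unit:
  assumes u: "norm (u :: complex) = 1" and w: "norm w = 1" and d: "norm (u - w) \<le> 6/5"
    and r: "0 \<le> r" "r \<le> 1"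
  shows "norm (of_real r * u - of_real (1/4) * w) \<le> 97/100"
proof -
  have n: "(norm (of_real s * u - of_real t * w))\<^sup>2 = s\<^sup>2 - 2 * s * t * (u \<bullet> w) + t\<^sup>2" for s t :: real
  proof -
    have "u \<bullet> u = 1" "w \<bullet> w = 1" using u w by (simp_all add: dot_square_norm)
    then have "(norm (s *\<^sub>R u - t *\<^sub>R w))\<^sup>2 = s\<^sup>2 - 2 * s * t * (u \<bullet> w) + t\<^sup>2"
      unfolding dot_square_norm[symmetric]
      by (simp add: inner_diff_left inner_diff_right inner_commute[of w u] power2_eq_square algebra_simps)
    then show ?thesis by (simp only: scaleR_conv_of_real)
  qed
  have "(norm (u - w))\<^sup>2 \<le> (6/5)\<^sup>2" using d by (intro power_mono) auto
  then have i: "u \<bullet> w \<ge> 7/25" using n[of 1 1] by (simp add: power2_eq_square)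
  have "r * (7/25) \<le> r * (u \<bullet> w)" using i r by (intro mult_left_mono) auto
  moreover have "r * r \<le> r" using r by (simp add: mult_left_le)
  ultimately have "(norm (of_real r * u - of_real (1/4) * w))\<^sup>2 \<le> (97/100)\<^sup>2"
    unfolding n using r by (simp add: power2_eq_square)
  then show ?thesis by (rule power2_le_imp_le) simp
qed

lemma I0_set_of_bounded_by_1:
  assumes "\<And>\<phi>. (\<And>\<gamma>. \<gamma> \<in> E \<Longrightarrow> norm (\<phi> \<gamma>) \<le> 1) \<Longrightarrow> discrete_transform_on E \<phi>"
  shows "I0_set E"
  unfolding I0_set_iff_discrete_transform_on
proof (intro allI impI)
  fix \<phi> :: "'a \<Rightarrow> complex" assume "bounded (\<phi> ` E)"
  then obtain B where B: "B > 0" "\<And>\<gamma>. \<gamma> \<in> E \<Longrightarrow> norm (\<phi> \<gamma>) \<le> B"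
    by (auto simp: bounded_pos)
  then have "discrete_transform_on E (\<lambda>\<gamma>. \<phi> \<gamma> / of_real B)"
    by (intro assms) (simp add: norm_divide)
  from discrete_transform_on_cmult[OF this, of "of_real B"] B
  show "discrete_transform_on E \<phi>" by simp
qed

text \<open>A character approximates the direction of the function to be interpolated; subtracting a
  quarter of it shrinks the uniform bound to 97/100, and the geometric iteration does the
  rest.\<close>

lemma I0_set_of_weak_Kronecker:
  assumes "weak_Kronecker (6/5) E" shows "I0_set E"
proof (rule I0_set_of_bounded_by_1)
  fix \<phi> :: "'a \<Rightarrow> complex" assume \<phi>: "\<And>\<gamma>. \<gamma> \<in> E \<Longrightarrow> norm (\<phi> \<gamma>) \<le> 1"
  let ?S = "{\<psi> :: 'a \<Rightarrow> complex. \<forall>\<gamma>\<in>E. norm (\<psi> \<gamma>) \<le> 1}"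
  show "discrete_transform_on E \<phi>"
  proof (rule discrete_transform_on_iterate[where S = ?S and q = "97/100" and c = "1/4"])
    fix \<psi> :: "'a \<Rightarrow> complex" assume "\<psi> \<in> ?S"
    then have \<psi>: "\<And>\<gamma>. \<gamma> \<in> E \<Longrightarrow> norm (\<psi> \<gamma>) \<le> 1" by simp
    \<comment> \<open>Where \<open>\<psi>\<close> vanishes, any direction will do.\<close>
    define u where "u \<gamma> = (if \<psi> \<gamma> = 0 then 1 else sgn (\<psi> \<gamma>))" for \<gamma>
    have u: "norm (u \<gamma>) = 1" "of_real (norm (\<psi> \<gamma>)) * u \<gamma> = \<psi> \<gamma>" for \<gamma>
      by (simp_all add: u_def norm_sgn) (simp add: sgn_eq)
    \<comment> \<open>Conjugated because the transform involves
      \<open>cnj (x \<gamma>)\<close>.\<close>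
    have "\<forall>\<gamma>\<in>E. norm (cnj (u \<gamma>)) = 1" using u by simp
    then obtain x where x: "x \<in> dual_group" "\<forall>\<gamma>\<in>E. norm (cnj (u \<gamma>) - x \<gamma>) \<le> 6/5"
      using spec[OF assms[unfolded weak_Kronecker_def], of "\<lambda>\<gamma>. cnj (u \<gamma>)"] by auto
    have "norm ((\<psi> \<gamma> - complex_of_real (1/4) * cnj (x \<gamma>)) / complex_of_real (97/100)) \<le> 1"
      if g: "\<gamma> \<in> E" for \<gamma>
    proof -
      have "norm (u \<gamma> - cnj (x \<gamma>)) \<le> 6/5"
        using x(2) g complex_mod_cnj[of "u \<gamma> - cnj (x \<gamma>)"] by (metis complex_cnj_cnj complex_cnj_diff)
      moreover have "norm (cnj (x \<gamma>)) = 1" using x(1) by (simp add: dual_group_def)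
      ultimately have "norm (of_real (norm (\<psi> \<gamma>)) * u \<gamma> - of_real (1/4) * cnj (x \<gamma>)) \<le> 97/100"
        using \<psi>[OF g] by (intro near_scaled_unit u) auto
      then show ?thesis unfolding u(2) norm_divide by simp
    qed
    then show "\<exists>x\<in>dual_group. (\<lambda>\<gamma>. (\<psi> \<gamma> - complex_of_real (1/4) * cnj (x \<gamma>)) / complex_of_real (97/100)) \<in> ?S"
      using x by blast
  qed (use \<phi> in auto)
qed

text \<open>Subtracting half its sign from a real number in [-1, 1] leaves modulus at most 1/2, so
  the iteration runs with \<open>c\<close> and \<open>q\<close> both 1/2. Complex functions are
  split into real and imaginary parts.\<close>

lemma I0_set_of_signs:
  assumes signs: "\<And>s. (\<And>\<gamma>. s \<gamma> = 1 \<or> s \<gamma> = - 1) \<Longrightarrow> \<exists>x\<in>dual_group. \<forall>\<gamma>\<in>E. x \<gamma> = s \<gamma>"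
  shows "I0_set E"
proof (rule I0_set_of_bounded_by_1)
  fix \<phi> :: "'a \<Rightarrow> complex" assume \<phi>: "\<And>\<gamma>. \<gamma> \<in> E \<Longrightarrow> norm (\<phi> \<gamma>) \<le> 1"
  let ?S = "{\<psi> :: 'a \<Rightarrow> complex. \<forall>\<gamma>\<in>E. Im (\<psi> \<gamma>) = 0 \<and> \<bar>Re (\<psi> \<gamma>)\<bar> \<le> 1}"
  have real: "discrete_transform_on E \<psi>" if "\<psi> \<in> ?S" for \<psi>
    using _ _ _ _ that
  proof (rule discrete_transform_on_iterate[where q = "1/2" and c = "1/2"])
    fix \<psi> \<gamma> assume "\<psi> \<in> ?S" "\<gamma> \<in> E"
    then show "norm (\<psi> \<gamma>) \<le> 1" by (simp add: cmod_def)
  next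
    fix \<psi> assume \<psi>: "\<psi> \<in> ?S"
    define s where "s \<gamma> = (if Re (\<psi> \<gamma>) \<ge> 0 then 1 else - 1 :: complex)" for \<gamma>
    have "s \<gamma> = 1 \<or> s \<gamma> = - 1" for \<gamma> by (simp add: s_def)
    then obtain x where x: "x \<in> dual_group" "\<forall>\<gamma>\<in>E. x \<gamma> = s \<gamma>" using signs[of s] by blast
    then have "(\<lambda>\<gamma>. (\<psi> \<gamma> - complex_of_real (1/2) * cnj (x \<gamma>)) / complex_of_real (1/2)) \<in> ?S"
      using \<psi> by (auto simp: s_def abs_le_iff)
    with x show "\<exists>x\<in>dual_group. (\<lambda>\<gamma>. (\<psi> \<gamma> - complex_of_real (1/2) * cnj (x \<gamma>)) / complex_of_real (1/2)) \<in> ?S"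
      by blast
  qed auto
  have "discrete_transform_on E (\<lambda>\<gamma>. of_real (Re (\<phi> \<gamma>)) + \<i> * of_real (Im (\<phi> \<gamma>)))"
    by (intro discrete_transform_on_add discrete_transform_on_cmult real)
      (auto intro: order_trans[OF abs_Re_le_cmod \<phi>] order_trans[OF abs_Im_le_cmod \<phi>])
  then show "discrete_transform_on E \<phi>" by (simp flip: complex_eq)
qed

text \<open>For unimodular \<open>z\<close>, the sign \<open>s\<close> of its real part satisfies |z
  - s|^2 = 2 - 2 |Re z|.\<close>

lemma weak_Kronecker_of_signs:
  assumes signs: "\<And>s. (\<And>\<gamma>. s \<gamma> = 1 \<or> s \<gamma> = - 1) \<Longrightarrow> \<exists>x\<in>dual_group. \<forall>\<gamma>\<in>E. x \<gamma> = s \<gamma>"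
  shows "weak_Kronecker (sqrt 2) E"
  unfolding weak_Kronecker_def
proof (intro allI impI)
  fix \<phi> :: "'a \<Rightarrow> complex" assume \<phi>: "\<forall>\<gamma>\<in>E. norm (\<phi> \<gamma>) = 1"
  define s where "s \<gamma> = (if Re (\<phi> \<gamma>) \<ge> 0 then 1 else - 1 :: complex)" for \<gamma>
  have "s \<gamma> = 1 \<or> s \<gamma> = - 1" for \<gamma> by (simp add: s_def)
  then obtain x where x: "x \<in> dual_group" "\<forall>\<gamma>\<in>E. x \<gamma> = s \<gamma>" using signs[of s] by blast
  have "norm (\<phi> \<gamma> - x \<gamma>) \<le> sqrt 2" if "\<gamma> \<in> E" for \<gamma>
  proof -
    have "(Re (\<phi> \<gamma>))\<^sup>2 + (Im (\<phi> \<gamma>))\<^sup>2 = 1" using \<phi> that by (simp flip: cmod_power2)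
    then have "(Re (\<phi> \<gamma> - s \<gamma>))\<^sup>2 + (Im (\<phi> \<gamma> - s \<gamma>))\<^sup>2 \<le> 2"
      by (auto simp: s_def power2_eq_square algebra_simps)
    then show ?thesis using x(2) that by (simp add: cmod_def)
  qed
  with x show "\<exists>x\<in>dual_group. \<forall>\<gamma>\<in>E. norm (\<phi> \<gamma> - x \<gamma>) \<le> sqrt 2" by blast
qed

section \<open>Failure of interpolation on the union\<close>

text \<open>By compactness of a finite-dimensional torus, the first \<open>N\<close> characters
  converge along a subsequence of \<open>f\<close>, so they barely distinguish two late terms of
  it.\<close>

lemma dual_group_differences_recur:
  fixes f :: "nat \<Rightarrow> 'a::ab_group_add" and x :: "nat \<Rightarrow> 'a \<Rightarrow> complex"
  assumes x: "\<And>k. x k \<in> dual_group" and \<delta>: "\<delta> > 0"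
  shows "\<exists>i j. i < j \<and> (\<forall>k<N. norm (1 - x k (f i - f j)) < \<delta>)"
proof -
  have "\<exists>r. strict_mono r \<and> (\<forall>k<N. convergent (\<lambda>n. x k (f (r n))))"
  proof (induction N)
    case 0 then show ?case using strict_mono_id by auto
  next
    case (Suc N)
    then obtain r where r: "strict_mono r" "\<And>k. k < N \<Longrightarrow> convergent (\<lambda>n. x k (f (r n)))" by blast
    have "\<forall>n. x N (f (r n)) \<in> sphere 0 1" using x by (simp add: dual_group_def)
    then obtain l t where t: "strict_mono t" "((\<lambda>n. x N (f (r n))) \<circ> t) \<longlonglongrightarrow> l"
      using compact_sphere[THEN compact_imp_seq_compact, THEN seq_compactE] by metis
    have "convergent (\<lambda>n. x k (f ((r \<circ> t) n)))" if "k < Suc N" for k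
    proof (cases "k = N")
      case True then show ?thesis using t(2) by (auto simp: convergent_def o_def)
    next
      case False
      then have "convergent ((\<lambda>n. x k (f (r n))) \<circ> t)"
        using that r t(1) by (intro convergent_subseq_convergent) auto
      then show ?thesis by (simp add: o_def)
    qed
    with r t show ?case by (intro exI[of _ "r \<circ> t"]) (auto intro: strict_mono_o simp del: o_apply)
  qed
  then obtain r where r: "strict_mono r" "\<And>k. k < N \<Longrightarrow> convergent (\<lambda>n. x k (f (r n)))" by blast
  have "\<forall>k<N. \<exists>M. \<forall>m\<ge>M. \<forall>n\<ge>M. norm (x k (f (r m)) - x k (f (r n))) < \<delta>"
    using r(2) \<delta> by (simp add: Cauchy_convergent_iff[symmetric] Cauchy_iff)
  then obtain M where M: "\<And>k m n. k < N \<Longrightarrow> m \<ge> M k \<Longrightarrow> n \<ge> M k \<Longrightarrow>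
      norm (x k (f (r m)) - x k (f (r n))) < \<delta>" by metis
  \<comment> \<open>\<open>insert 0\<close> keeps the set nonempty when
    \<open>N = 0\<close>.\<close>
  define m where "m = Max (insert 0 (M ` {..<N}))"
  have m: "M k \<le> m" if "k < N" for k using that by (auto simp: m_def intro!: Max_ge)
  have "norm (1 - x k (f (r m) - f (r (Suc m)))) < \<delta>" if k: "k < N" for k
  proof -
    have n: "norm (x k g) = 1" for g using x by (simp add: dual_group_def)
    have "x k (f (r m)) = x k (f (r m) - f (r (Suc m))) * x k (f (r (Suc m)))"
      using x[of k] by (simp add: dual_group_def) (metis diff_add_cancel)
    then have "x k (f (r (Suc m))) - x k (f (r m))
        = (1 - x k (f (r m) - f (r (Suc m)))) * x k (f (r (Suc m)))"
      by (simp add: algebra_simps)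
    then have "norm (1 - x k (f (r m) - f (r (Suc m)))) = norm (x k (f (r (Suc m))) - x k (f (r m)))"
      by (simp add: norm_mult n)
    then show ?thesis using M[OF k, of "Suc m" m] m[OF k] by simp
  qed
  moreover have "r m < r (Suc m)" using r(1) by (simp add: strict_mono_Suc_iff)
  ultimately show ?thesis by blast
qed

text \<open>A discrete measure with transform 1 on \<open>E\<close> and 0 on \<open>E'\<close> has
  nearly all its mass on finitely many atoms. Recurrence yields a difference
  \<open>f i - f j\<close> at which these atoms are nearly 1, so the transform cannot drop from 1 to
  0 under that translation.\<close>

lemma not_I0_set_union:
  fixes f :: "nat \<Rightarrow> 'a::ab_group_add"
  assumes disj: "E \<inter> E' = {}"
    and near: "\<And>i j. i < j \<Longrightarrow> \<exists>g\<in>E. g + (f i - f j) \<in> E'"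
  shows "\<not> I0_set (E \<union> E')"
proof
  assume I0: "I0_set (E \<union> E')"
  define \<phi> where "\<phi> g = (if g \<in> E then 1 else 0 :: complex)" for g
  have "bounded (\<phi> ` (E \<union> E'))" by (rule boundedI[of _ 1]) (auto simp: \<phi>_def)
  then obtain a :: "nat \<Rightarrow> complex" and x where a: "summable (\<lambda>k. norm (a k))"
    and x: "\<And>k. x k \<in> dual_group" and s: "\<And>\<gamma>. \<gamma> \<in> E \<union> E' \<Longrightarrow> (\<lambda>k. a k * cnj (x k \<gamma>)) sums \<phi> \<gamma>"
    using I0 unfolding I0_set_iff_discrete_transform_on discrete_transform_on_def by blast
  \<comment> \<open>Tail terms count at most twice, for a total of at most 1/4; the first
    \<open>N\<close> terms will contribute at most 1/2.\<close>
  obtain N where N: "norm (\<Sum>k. norm (a (k + N))) < 1/8"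
    using suminf_exist_split[OF _ a, of "1/8"] by auto
  define A where "A = (\<Sum>k<N. norm (a k))"
  have A: "A \<ge> 0" by (simp add: A_def sum_nonneg)
  \<comment> \<open>Makes \<open>A * \<delta>\<close> at most 1/2; the added 1 covers
    \<open>A = 0\<close>.\<close>
  define \<delta> where "\<delta> = 1 / (2 * (A + 1))"
  have \<delta>: "\<delta> > 0" using A by (simp add: \<delta>_def)
  obtain i j where ij: "i < j" "\<And>k. k < N \<Longrightarrow> norm (1 - x k (f i - f j)) < \<delta>"
    using dual_group_differences_recur[of x, OF x \<delta>] by metis
  obtain g where g: "g \<in> E" "g + (f i - f j) \<in> E'" using near[OF ij(1)] by blast
  define d where "d k = a k * cnj (x k g) - a k * cnj (x k (g + (f i - f j)))" for k
  have d: "d sums 1"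
  proof -
    have "\<phi> g = 1" "\<phi> (g + (f i - f j)) = 0" using g disj by (auto simp: \<phi>_def)
    then show ?thesis unfolding d_def using sums_diff[OF s[of g] s[of "g + (f i - f j)"]] g by simp
  qed
  have nd: "norm (d k) = norm (a k) * norm (1 - x k (f i - f j))" for k
  proof -
    have "d k = a k * cnj (x k g) * cnj (1 - x k (f i - f j))"
    proof -
      have "x k (g + (f i - f j)) = x k g * x k (f i - f j)" using x[of k] by (simp add: dual_group_def)
      then show ?thesis by (simp add: d_def right_diff_distrib)
    qed
    then show ?thesis using x[of k] by (simp add: norm_mult dual_group_def del: complex_cnj_diff)
  qed
  have n2: "norm (1 - x k h) \<le> 2" for k h
    using norm_triangle_ineq4[of 1 "x k h"] x[of k] by (simp add: dual_group_def)
  have le: "norm (d k) \<le> 2 * norm (a k)" for k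
    using mult_left_mono[OF n2[of k "f i - f j"], of "norm (a k)"] by (simp add: nd mult.commute)
  have sa: "summable (\<lambda>k. 2 * norm (a (k + N)))" using a by (intro summable_mult summable_ignore_initial_segment)
  have sd: "summable (\<lambda>k. norm (d k))"
    by (rule summable_comparison_test'[OF summable_mult[OF a, of 2], of 0]) (use le in auto)
  have "1 = norm (\<Sum>k. d k)" using d by (simp add: sums_iff)
  also have "\<dots> \<le> (\<Sum>k. norm (d k))" using sd by (rule summable_norm)
  also have "\<dots> = (\<Sum>k. norm (d (k + N))) + (\<Sum>k<N. norm (d k))" using sd by (rule suminf_split_initial_segment)
  also have "(\<Sum>k. norm (d (k + N))) \<le> (\<Sum>k. 2 * norm (a (k + N)))"
    using sd sa le by (intro suminf_le) (auto simp: summable_iff_shift[of "\<lambda>k. norm (d k)"])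
  also have "(\<Sum>k. 2 * norm (a (k + N))) \<le> 1/4"
    using N a by (subst suminf_mult) (auto simp: summable_iff_shift[of "\<lambda>k. norm (a k)"])
  also have "(\<Sum>k<N. norm (d k)) \<le> (\<Sum>k<N. norm (a k) * \<delta>)"
    unfolding nd by (intro sum_mono mult_left_mono less_imp_le[OF ij(2)]) auto
  also have "\<dots> = A * \<delta>" by (simp add: A_def sum_distrib_right)
  also have "A * \<delta> \<le> 1/2" using A by (simp add: \<delta>_def field_simps)
  finally show False by simp
qed

section \<open>Lacunary sequences of real numbers\<close>

text \<open>Nested intervals: by periodicity an exact solution \<open>v n\<close> exists within
  \<open>pi / \<bar>p n\<bar>\<close> of any given point, and radius
  \<open>1 / \<bar>p n\<bar>\<close> around it costs an error of at most 1. The ratio 7 exceeds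
  \<open>1 + pi\<close>, so each interval contains the next.\<close>

lemma lacunary_Kronecker:
  fixes p :: "nat \<Rightarrow> real" and t :: "nat \<Rightarrow> complex"
  assumes p0: "p 0 \<noteq> 0" and p: "\<And>n. \<bar>p (Suc n)\<bar> \<ge> 7 * \<bar>p n\<bar>" and t: "\<And>n. norm (t n) = 1"
  shows "\<exists>s. \<forall>n. norm (t n - cis (s * p n)) \<le> 1"
proof -
  have nz: "p n \<noteq> 0" for n
  proof (induction n)
    case (Suc n)
    then have "0 < 7 * \<bar>p n\<bar>" by simp
    with p[of n] show ?case by linarith
  qed (rule p0)
  have hit: "\<exists>v. cis (v * p n) = t n \<and> \<bar>v - u\<bar> \<le> pi / \<bar>p n\<bar>" for u n
  proof -
    have "norm (t n / cis (u * p n)) = 1" using t by (simp add: norm_divide)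
    then obtain \<theta> where \<theta>: "cis \<theta> = t n / cis (u * p n)" "\<bar>\<theta>\<bar> \<le> pi" using unit_eq_cis by blast
    have "cis ((u + \<theta> / p n) * p n) = cis (u * p n) * cis \<theta>"
      using nz by (simp add: distrib_right cis_mult)
    then have "cis ((u + \<theta> / p n) * p n) = t n" using \<theta> by simp
    moreover have "\<bar>u + \<theta> / p n - u\<bar> \<le> pi / \<bar>p n\<bar>" using \<theta>(2) by (simp add: divide_right_mono)
    ultimately show ?thesis by blast
  qed
  have "\<exists>v. \<forall>n. cis (v n * p n) = t n \<and> \<bar>v (Suc n) - v n\<bar> \<le> pi / \<bar>p (Suc n)\<bar>"
    by (rule dependent_nat_choice) (use hit in blast)+
  then obtain v where v: "\<And>n. cis (v n * p n) = t n" "\<And>n. \<bar>v (Suc n) - v n\<bar> \<le> pi / \<bar>p (Suc n)\<bar>"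
    by blast
  define B where "B n = cball (v n) (1 / \<bar>p n\<bar>)" for n
  have "B (Suc n) \<subseteq> B n" for n
  proof
    fix y assume "y \<in> B (Suc n)"
    then have "\<bar>y - v (Suc n)\<bar> \<le> 1 / \<bar>p (Suc n)\<bar>" by (simp add: B_def dist_real_def abs_minus_commute)
    with v(2)[of n] have "\<bar>y - v n\<bar> \<le> (1 + pi) / \<bar>p (Suc n)\<bar>" by (simp add: add_divide_distrib)
    also have "\<dots> \<le> 7 / \<bar>p (Suc n)\<bar>" using pi_less_4 by (intro divide_right_mono) auto
    also have "\<dots> \<le> 7 / (7 * \<bar>p n\<bar>)" using p[of n] nz[of n] by (intro divide_left_mono) auto
    finally show "y \<in> B n" by (simp add: B_def dist_real_def abs_minus_commute)
  qed
  then have "B n \<subseteq> B m" if "m \<le> n" for m n using lift_Suc_antimono_le[of B] that by blast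
  then have "\<Inter>(range B) \<noteq> {}" by (intro compact_nest) (auto simp: B_def)
  then obtain s where s: "\<And>n. s \<in> B n" by blast
  have "norm (t n - cis (s * p n)) \<le> 1" for n
  proof -
    have "t n - cis (s * p n) = cis (s * p n) * (cis ((v n - s) * p n) - 1)"
      using v(1)[of n] by (simp add: right_diff_distrib cis_mult left_diff_distrib)
    then have "norm (t n - cis (s * p n)) = norm (cis ((v n - s) * p n) - 1)" by (simp add: norm_mult)
    also have "\<dots> \<le> \<bar>(v n - s) * p n\<bar>"
      using dist_exp_i_1[of "(v n - s) * p n"] abs_sin_x_le_abs_x[of "(v n - s) * p n / 2"]
      by (simp add: cis_conv_exp mult.commute)
    also have "\<dots> \<le> 1"
      using s[of n] nz[of n] unfolding abs_mult by (simp add: B_def dist_real_def field_simps)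
    finally show ?thesis .
  qed
  then show ?thesis by blast
qed

section \<open>Choice of the translates\<close>

text \<open>The constant fits every case: lacunary and independent choices give 6/5, while signs
  give \<open>sqrt 2\<close>.\<close>

definition Kronecker_I0 :: "'a::ab_group_add set \<Rightarrow> bool" where
  "Kronecker_I0 E \<longleftrightarrow> I0_set E \<and> weak_Kronecker (sqrt 2) E"

lemma Kronecker_I0_of_weak_Kronecker:
  assumes "weak_Kronecker (6/5) E" shows "Kronecker_I0 E"
proof -
  have "(6/5 :: real) \<le> sqrt 2" by (rule real_le_rsqrt) (simp add: power2_eq_square)
  then show ?thesis using assms
    by (simp add: Kronecker_I0_def I0_set_of_weak_Kronecker weak_Kronecker_mono)
qed

lemma weak_Kronecker_range:
  fixes e :: "nat \<Rightarrow> 'a::ab_group_add"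
  assumes "\<And>t. (\<And>n. norm (t n) = 1) \<Longrightarrow> \<exists>x\<in>dual_group. \<forall>n. norm (t n - x (e n)) \<le> \<epsilon>"
  shows "weak_Kronecker \<epsilon> (range e)"
  unfolding weak_Kronecker_def
proof (intro allI impI)
  fix \<phi> :: "'a \<Rightarrow> complex" assume "\<forall>\<gamma>\<in>range e. norm (\<phi> \<gamma>) = 1"
  then have "norm (\<phi> (e n)) = 1" for n by blast
  then obtain x where "x \<in> dual_group" "\<forall>n. norm (\<phi> (e n) - x (e n)) \<le> \<epsilon>"
    using assms[of "\<lambda>n. \<phi> (e n)"] by blast
  then show "\<exists>x\<in>dual_group. \<forall>\<gamma>\<in>range e. norm (\<phi> \<gamma> - x \<gamma>) \<le> \<epsilon>" by blast
qed

lemma cis_hom_in_dual_group: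
  fixes p :: "'a::ab_group_add \<Rightarrow> real"
  assumes "\<And>g h. p (g + h) = p g + p h"
  shows "(\<lambda>g. cis (s * p g)) \<in> dual_group"
  using assms by (simp add: dual_group_def cis_mult distrib_left)

lemma Kronecker_I0_lacunary:
  fixes p :: "'a::ab_group_add \<Rightarrow> real"
  assumes add: "\<And>g h. p (g + h) = p g + p h"
    and "p (e 0) \<noteq> 0" "\<And>n. \<bar>p (e (Suc n))\<bar> \<ge> 7 * \<bar>p (e n)\<bar>"
  shows "Kronecker_I0 (range e)"
proof (intro Kronecker_I0_of_weak_Kronecker weak_Kronecker_range)
  fix t :: "nat \<Rightarrow> complex" assume "\<And>n. norm (t n) = 1"
  then obtain s where s: "\<And>n. norm (t n - cis (s * p (e n))) \<le> 1"
    using lacunary_Kronecker[of "\<lambda>n. p (e n)" t] assms by blast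
  have "norm (t n - cis (s * p (e n))) \<le> 6/5" for n using s[of n] by linarith
  then show "\<exists>x\<in>dual_group. \<forall>n. norm (t n - x (e n)) \<le> 6/5"
    by (intro bexI[of _ "\<lambda>g. cis (s * p g)"] cis_hom_in_dual_group allI add)
qed

text \<open>Each \<open>e n\<close> has order at least three or infinite modulo
  \<open>\<Lambda> n\<close>, so its value can be brought within 6/5 of the target while the earlier
  values stay fixed.\<close>

lemma Kronecker_I0_of_dissociate:
  fixes \<Lambda> :: "nat \<Rightarrow> 'a::ab_group_add set"
  assumes sub: "\<And>n. int_module.subspace (\<Lambda> n)" and mono: "\<And>n. \<Lambda> n \<subseteq> \<Lambda> (Suc n)"
    and e: "\<And>n. e n \<in> \<Lambda> (Suc n)" and out: "\<And>n. e n \<notin> \<Lambda> n" "\<And>n. e n + e n \<notin> \<Lambda> n"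
  shows "Kronecker_I0 (range e)"
proof (intro Kronecker_I0_of_weak_Kronecker weak_Kronecker_range)
  fix t :: "nat \<Rightarrow> complex" assume t: "\<And>n. norm (t n) = 1"
  show "\<exists>x\<in>dual_group. \<forall>n. norm (t n - x (e n)) \<le> 6/5"
    by (rule dual_group_interpolate[where \<Lambda> = \<Lambda> and e = e and c = 0, OF sub mono e])
      (rule int_module.subspace_0[OF sub], rule dual_group_extend_near[OF _ sub t out])
qed

text \<open>For characters trivial at \<open>c\<close>, each \<open>e n\<close> takes a value of
  square 1; as \<open>e n\<close> is outside \<open>\<Lambda> n\<close>, both signs remain available
  at every stage.\<close>

lemma Kronecker_I0_of_constant_double:
  fixes \<Lambda> :: "nat \<Rightarrow> 'a::ab_group_add set"
  assumes sub: "\<And>n. int_module.subspace (\<Lambda> n)" and mono: "\<And>n. \<Lambda> n \<subseteq> \<Lambda> (Suc n)"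
    and e: "\<And>n. e n \<in> \<Lambda> (Suc n)" and c: "\<And>n. c \<in> \<Lambda> n"
    and out: "\<And>n. e n \<notin> \<Lambda> n" and double: "\<And>n. e n + e n = c"
  shows "Kronecker_I0 (range e)"
proof -
  have signs: "\<exists>x\<in>dual_group. \<forall>\<gamma>\<in>range e. x \<gamma> = s \<gamma>" if s: "\<And>\<gamma>. s \<gamma> = 1 \<or> s \<gamma> = - 1" for s
  proof -
    have "\<exists>x\<in>dual_group. \<forall>n. x (e n) = s (e n)"
    proof (rule dual_group_interpolate[where \<Lambda> = \<Lambda> and e = e and c = c, OF sub mono e c])
      fix n and x :: "'a \<Rightarrow> complex" assume "x \<in> dual_group" "x c = 1"
      then show "\<exists>y\<in>dual_group. (\<forall>g\<in>\<Lambda> n. y g = x g) \<and> y (e n) = s (e n)"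
        by (intro dual_group_extend_sign sub s) (simp_all add: out double c)
    qed
    then show ?thesis by blast
  qed
  show ?thesis unfolding Kronecker_I0_def
    by (intro conjI I0_set_of_signs weak_Kronecker_of_signs signs)
qed

lemma bounded_additive_double:
  fixes p :: "'a::ab_group_add \<Rightarrow> real"
  assumes add: "\<And>g h. p (g + h) = p g + p h" and "bounded (p ` F)"
  shows "bounded (p ` ((\<lambda>g. g + g) ` F))"
proof -
  have "p ` ((\<lambda>g. g + g) ` F) = (\<lambda>r. 2 *\<^sub>R r) ` (p ` F)" by (auto simp: add image_image)
  then show ?thesis using bounded_scaling[OF assms(2), of 2] by simp
qed

section \<open>Escape from finitely generated subgroups\<close>

lemma infinite_set_trichotomy:
  fixes F :: "'a::ab_group_add set"
  assumes "infinite F"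
  obtains (unbounded) p :: "'a \<Rightarrow> real" where "\<And>g h. p (g + h) = p g + p h" "\<not> bounded (p ` F)"
  | (escaping) "\<And>S. finite S \<Longrightarrow> \<exists>g\<in>F. g \<notin> generated S \<and> g + g \<notin> generated S"
  | (double) c F' where "F' \<subseteq> F" "infinite F'" "\<And>g. g \<in> F' \<Longrightarrow> g + g = c"
      "\<And>S. finite S \<Longrightarrow> \<exists>g\<in>F'. g \<notin> generated S"
proof (cases "\<exists>p :: 'a \<Rightarrow> real. (\<forall>g h. p (g + h) = p g + p h) \<and> \<not> bounded (p ` F)")
  case True
  then show ?thesis using unbounded by blast
next
  case False
  \<comment> \<open>An infinite intersection would carry an unbounded real homomorphism, whereas all
    of them are bounded on \<open>F\<close> and hence on its doubles.\<close>
  have fin: "finite (A \<inter> generated S)"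
    if S: "finite S" and A: "A \<subseteq> F \<or> A \<subseteq> (\<lambda>g. g + g) ` F" for A S
  proof (rule ccontr)
    assume "infinite (A \<inter> generated S)"
    then obtain p :: "'a \<Rightarrow> real" where p: "\<forall>g h. p (g + h) = p g + p h" "\<not> bounded (p ` (A \<inter> generated S))"
      using infinite_generated_unbounded_hom[OF S] by blast
    have "bounded (p ` F)" using False p(1) by blast
    then have "bounded (p ` A)"
      using A bounded_additive_double[of p F] p(1) by (meson bounded_subset image_mono)
    then show False using p(2) by (meson bounded_subset image_mono inf_le1)
  qed
  show ?thesis
  proof (cases "\<forall>S. finite S \<longrightarrow> (\<exists>g\<in>F. g \<notin> generated S \<and> g + g \<notin> generated S)")
    case True
    then show ?thesis using escaping by blast
  next
    case False
    then obtain S where S: "finite S" "\<forall>g\<in>F. g \<in> generated S \<or> g + g \<in> generated S" by blast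
    \<comment> \<open>An element of the subgroup has its double there too, so failure of escape
      traps every double, and only finitely many doubles occur.\<close>
    have "(\<lambda>g. g + g) ` F \<subseteq> generated S" using S(2) by (auto intro: int_module.span_add)
    then have "finite ((\<lambda>g. g + g) ` F)" using fin[OF S(1), of "(\<lambda>g. g + g) ` F"] by (simp add: Int_absorb2)
    then obtain a where a: "infinite {g \<in> F. g + g = a + a}"
      using pigeonhole_infinite[OF assms] by blast
    show ?thesis
    proof (rule double[OF _ a])
      fix T :: "'a set" assume "finite T"
      then have "finite ({g \<in> F. g + g = a + a} \<inter> generated T)" by (intro fin) auto
      then have "\<not> {g \<in> F. g + g = a + a} \<subseteq> generated T" using a by (metis inf.absorb1)
      then show "\<exists>g\<in>{g \<in> F. g + g = a + a}. g \<notin> generated T" by blast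
    qed auto
  qed
qed

text \<open>In a coincidence \<open>g m = g n + h n\<close> the term \<open>g\<close> of larger
  index would lie in its own \<open>\<Lambda>\<close>; equal indices would make \<open>h n\<close>
  zero.\<close>

lemma disjoint_translates_escaping:
  fixes \<Lambda> :: "nat \<Rightarrow> 'a::ab_group_add set"
  assumes sub: "\<And>n. int_module.subspace (\<Lambda> n)" and mono: "\<And>n. \<Lambda> n \<subseteq> \<Lambda> (Suc n)"
    and g: "\<And>n. g n \<notin> \<Lambda> n" "\<And>n. g n \<in> \<Lambda> (Suc n)" and h: "\<And>n. h n \<in> \<Lambda> n" "\<And>n. h n \<noteq> 0"
  shows "range g \<inter> range (\<lambda>n. g n + h n) = {}"
proof -
  have up: "\<Lambda> m \<subseteq> \<Lambda> n" if "m \<le> n" for m n using lift_Suc_mono_le[of \<Lambda>, OF mono that] .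
  have "g m \<noteq> g n + h n" for m n
  proof
    assume eq: "g m = g n + h n"
    consider "m < n" | "m = n" | "n < m" by linarith
    then show False
    proof cases
      case 1
      then have "g m \<in> \<Lambda> n" using g(2)[of m] up[of "Suc m" n] by auto
      then have "g m - h n \<in> \<Lambda> n" using h sub by (simp add: int_module.subspace_diff)
      then show False using g(1)[of n] eq by simp
    next
      case 2 then show False using eq h(2)[of n] by simp
    next
      case 3
      then have "g n \<in> \<Lambda> m" "h n \<in> \<Lambda> m" using g(2)[of n] h(1)[of n] up[of "Suc n" m] up[of n m] by auto
      then have "g n + h n \<in> \<Lambda> m" using sub by (simp add: int_module.subspace_add)
      then show False using g(1)[of m] eq by simp
    qed
  qed
  then show ?thesis by blast
qed

text \<open>Course-of-values recursion. The parameter \<open>c\<close> reserves room in every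
  subgroup for the common double.\<close>

lemma choose_escaping:
  fixes h :: "nat \<Rightarrow> 'a::ab_group_add"
  assumes "\<forall>S. finite S \<longrightarrow> (\<exists>g\<in>F. Q (generated S) g)"
  shows "\<exists>\<Lambda> g. \<forall>n :: nat. int_module.subspace (\<Lambda> n) \<and> \<Lambda> n \<subseteq> \<Lambda> (Suc n) \<and>
    g n \<in> F \<and> Q (\<Lambda> n) (g n) \<and> g n \<in> \<Lambda> (Suc n) \<and> h n \<in> \<Lambda> n \<and> c \<in> \<Lambda> n"
proof -
  \<comment> \<open>\<open>h\<close> enters up to \<open>n\<close> but \<open>g\<close> only below
    \<open>n\<close>: the new term must be independent of its own shift, and the subgroup must be
    known before the choice.\<close>
  define \<Lambda> where "\<Lambda> g n = generated (insert c (h ` {..n} \<union> g ` {..<n}))" for g :: "nat \<Rightarrow> 'a" and n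
  have "\<exists>g. \<forall>n. g n \<in> F \<and> Q (\<Lambda> g n) (g n)"
  proof (rule dependent_wellorder_choice)
    fix r and f g :: "nat \<Rightarrow> 'a" and n assume "\<And>m. m < n \<Longrightarrow> f m = g m"
    then have "f ` {..<n} = g ` {..<n}" by auto
    then show "(r \<in> F \<and> Q (\<Lambda> f n) r) = (r \<in> F \<and> Q (\<Lambda> g n) r)" by (simp add: \<Lambda>_def)
  next
    fix n and f :: "nat \<Rightarrow> 'a"
    have "finite (insert c (h ` {..n} \<union> f ` {..<n}))" by simp
    from assms[rule_format, OF this] show "\<exists>r. r \<in> F \<and> Q (\<Lambda> f n) r" unfolding \<Lambda>_def Bex_def .
  qed
  then obtain g where g: "\<And>n. g n \<in> F" "\<And>n. Q (\<Lambda> g n) (g n)" by blast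
  show ?thesis
  proof (intro exI[of _ "\<Lambda> g"] exI[of _ g] allI conjI)
    show "\<Lambda> g n \<subseteq> \<Lambda> g (Suc n)" for n unfolding \<Lambda>_def by (intro int_module.span_mono) auto
  qed (use g in \<open>auto simp: \<Lambda>_def intro: int_module.span_base\<close>)
qed

text \<open>Each \<open>p (g n)\<close> is chosen so large that the shift \<open>h n\<close> and all
  earlier terms are negligible, which makes both sequences lacunary.\<close>

lemma translates_unbounded:
  fixes p :: "'a::ab_group_add \<Rightarrow> real" and h :: "nat \<Rightarrow> 'a"
  assumes add: "\<And>g h. p (g + h) = p g + p h" and unb: "\<not> bounded (p ` F)" and h0: "\<And>n. h n \<noteq> 0"
  shows "\<exists>g. (\<forall>n. g n \<in> F) \<and> range g \<inter> range (\<lambda>n. g n + h n) = {} \<and>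
    Kronecker_I0 (range g) \<and> Kronecker_I0 (range (\<lambda>n. g n + h n))"
proof -
  define B where "B g n = (\<Sum>m<n. \<bar>p (g m)\<bar>) + (\<Sum>m\<le>n. \<bar>p (h m)\<bar>)" for g :: "nat \<Rightarrow> 'a" and n
  \<comment> \<open>Losing at most \<open>B g n\<close> to the shift still leaves factor 9, above
    the required 7; the added 1 keeps the values nonzero.\<close>
  have "\<exists>g. \<forall>n. g n \<in> F \<and> \<bar>p (g n)\<bar> > 10 * (1 + B g n)"
  proof (rule dependent_wellorder_choice)
    fix r and f g :: "nat \<Rightarrow> 'a" and n assume "\<And>m. m < n \<Longrightarrow> f m = g m"
    then have "B f n = B g n" by (simp add: B_def)
    then show "(r \<in> F \<and> \<bar>p r\<bar> > 10 * (1 + B f n)) = (r \<in> F \<and> \<bar>p r\<bar> > 10 * (1 + B g n))" by simp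
  next
    fix n and f :: "nat \<Rightarrow> 'a"
    show "\<exists>r. r \<in> F \<and> \<bar>p r\<bar> > 10 * (1 + B f n)"
      using unb unfolding bounded_iff by (auto simp: not_le)
  qed
  then obtain g where g: "\<And>n. g n \<in> F" "\<And>n. \<bar>p (g n)\<bar> > 10 * (1 + B g n)" by blast
  have hB: "\<bar>p (h n)\<bar> \<le> B g n" for n
  proof -
    have "\<bar>p (h n)\<bar> \<le> (\<Sum>m\<le>n. \<bar>p (h m)\<bar>)" by (rule member_le_sum) auto
    moreover have "0 \<le> (\<Sum>m<n. \<bar>p (g m)\<bar>)" by (simp add: sum_nonneg)
    ultimately show ?thesis unfolding B_def by linarith
  qed
  have gB: "\<bar>p (g m)\<bar> + \<bar>p (h m)\<bar> \<le> B g n" if "m < n" for m n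
  proof -
    have "\<bar>p (h m)\<bar> \<le> (\<Sum>m\<le>n. \<bar>p (h m)\<bar>)" by (rule member_le_sum) (use that in auto)
    moreover have "\<bar>p (g m)\<bar> \<le> (\<Sum>m<n. \<bar>p (g m)\<bar>)" by (rule member_le_sum) (use that in auto)
    ultimately show ?thesis by (simp add: B_def)
  qed
  have B0: "B g n \<ge> 0" for n using hB[of n] by linarith
  have "g m \<noteq> g n + h n" for m n
  proof
    assume eq: "g m = g n + h n"
    \<comment> \<open>With distinct indices, the value of \<open>p\<close> at the later
      \<open>g\<close> would be at most twice its own bound.\<close>
    consider "m < n" | "m = n" | "n < m" by linarith
    then show False
    proof cases
      case 1 then show False
        using eq add[of "g n" "h n"] g(2)[of n] gB[of m n] hB[of n] B0[of n] by auto
    next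
      case 2 then show False using eq h0[of n] by simp
    next
      case 3 then show False
        using eq add[of "g n" "h n"] g(2)[of m] gB[of n m] B0[of m] by auto
    qed
  qed
  then have "range g \<inter> range (\<lambda>n. g n + h n) = {}" by blast
  moreover have "Kronecker_I0 (range g)"
  proof (rule Kronecker_I0_lacunary[OF add])
    show "p (g 0) \<noteq> 0" using g(2)[of 0] B0[of 0] by auto
    show "\<bar>p (g (Suc n))\<bar> \<ge> 7 * \<bar>p (g n)\<bar>" for n
      using g(2)[of "Suc n"] gB[of n "Suc n"] B0[of "Suc n"] by auto
  qed
  moreover have "Kronecker_I0 (range (\<lambda>n. g n + h n))"
  proof (rule Kronecker_I0_lacunary[OF add])
    show "p (g 0 + h 0) \<noteq> 0" using add[of "g 0" "h 0"] g(2)[of 0] hB[of 0] B0[of 0] by auto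
    show "\<bar>p (g (Suc n) + h (Suc n))\<bar> \<ge> 7 * \<bar>p (g n + h n)\<bar>" for n
    proof -
      have "\<bar>p (g n + h n)\<bar> \<le> B g (Suc n)"
        unfolding add using gB[OF lessI, of n] abs_triangle_ineq[of "p (g n)" "p (h n)"] by linarith
      moreover have "\<bar>p (g (Suc n) + h (Suc n))\<bar> \<ge> \<bar>p (g (Suc n))\<bar> - \<bar>p (h (Suc n))\<bar>"
        unfolding add by linarith
      ultimately show ?thesis using g(2)[of "Suc n"] hB[of "Suc n"] B0[of "Suc n"] by simp
    qed
  qed
  ultimately show ?thesis using g(1) by blast
qed

text \<open>
  \<open>F'\<close> is a proper subset of \<open>F\<close> only when doubling is constant on it; the differences \<open>h n\<close> then
  have order two, which keeps doubling constant on the translates \<open>g n + h n\<close>.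
\<close>

lemma exists_translates:
  fixes F :: "'a::ab_group_add set"
  assumes "infinite F"
  shows "\<exists>F'\<subseteq>F. infinite F' \<and> (\<forall>h. (\<forall>n :: nat. \<exists>a\<in>F'. \<exists>b\<in>F'. a \<noteq> b \<and> h n = a - b) \<longrightarrow>
    (\<exists>g. (\<forall>n. g n \<in> F) \<and> range g \<inter> range (\<lambda>n. g n + h n) = {} \<and>
      Kronecker_I0 (range g) \<and> Kronecker_I0 (range (\<lambda>n. g n + h n))))"
  using assms
proof (cases rule: infinite_set_trichotomy)
  case (unbounded p)
  show ?thesis
  proof (intro exI[of _ F] conjI allI impI)
    fix h assume "\<forall>n :: nat. \<exists>a\<in>F. \<exists>b\<in>F. a \<noteq> b \<and> h n = a - b"
    then have "h n \<noteq> 0" for n by (metis eq_iff_diff_eq_0)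
    then show "\<exists>g. (\<forall>n. g n \<in> F) \<and> range g \<inter> range (\<lambda>n. g n + h n) = {} \<and>
      Kronecker_I0 (range g) \<and> Kronecker_I0 (range (\<lambda>n. g n + h n))"
      by (rule translates_unbounded[OF unbounded])
  qed (use assms in auto)
next
  case escaping
  show ?thesis
  proof (intro exI[of _ F] conjI allI impI)
    fix h assume "\<forall>n :: nat. \<exists>a\<in>F. \<exists>b\<in>F. a \<noteq> b \<and> h n = a - b"
    then have h0: "h n \<noteq> 0" for n by (metis eq_iff_diff_eq_0)
    have esc: "\<forall>S. finite S \<longrightarrow> (\<exists>g\<in>F. g \<notin> generated S \<and> g + g \<notin> generated S)"
      using escaping by blast
    obtain \<Lambda> g where all: "\<forall>n :: nat. int_module.subspace (\<Lambda> n) \<and> \<Lambda> n \<subseteq> \<Lambda> (Suc n) \<and>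
        g n \<in> F \<and> (g n \<notin> \<Lambda> n \<and> g n + g n \<notin> \<Lambda> n) \<and> g n \<in> \<Lambda> (Suc n) \<and> h n \<in> \<Lambda> n \<and> 0 \<in> \<Lambda> n"
      using choose_escaping[where F = F and Q = "\<lambda>H g. g \<notin> H \<and> g + g \<notin> H" and h = h and c = 0, OF esc]
      by (elim exE) (rule that)
    have sub: "int_module.subspace (\<Lambda> n)" and mono: "\<Lambda> n \<subseteq> \<Lambda> (Suc n)"
      and g: "g n \<in> F" "g n \<notin> \<Lambda> n \<and> g n + g n \<notin> \<Lambda> n" "g n \<in> \<Lambda> (Suc n)"
      and h: "h n \<in> \<Lambda> n" for n
      using all by blast+
    have h': "h n \<in> \<Lambda> (Suc n)" for n using h mono by blast
    \<comment> \<open>Translation by \<open>h n\<close> does not change the class modulo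
      \<open>\<Lambda> n\<close>, so \<open>g n + h n\<close> inherits the independence of
      \<open>g n\<close>.\<close>
    have cancel: "a + b \<notin> \<Lambda> n" if "a \<notin> \<Lambda> n" "b \<in> \<Lambda> n" for a b n
      using int_module.subspace_diff[OF sub, of "a + b" n b] that by auto
    have "g n + h n + (g n + h n) = g n + g n + (h n + h n)" for n by (simp add: algebra_simps)
    then have out2: "g n + h n + (g n + h n) \<notin> \<Lambda> n" for n
      using cancel g(2) int_module.subspace_add[OF sub h h] by metis
    have "Kronecker_I0 (range g)"
      by (rule Kronecker_I0_of_dissociate[of \<Lambda> g, OF sub mono g(3)]) (use g(2) in auto)
    moreover have "Kronecker_I0 (range (\<lambda>n. g n + h n))"
      by (rule Kronecker_I0_of_dissociate[of \<Lambda> "\<lambda>n. g n + h n", OF sub mono])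
        (use g h cancel out2 int_module.subspace_add[OF sub g(3) h'] in auto)
    moreover have "range g \<inter> range (\<lambda>n. g n + h n) = {}"
      by (rule disjoint_translates_escaping[of \<Lambda> g h, OF sub mono]) (use g h h0 in auto)
    ultimately show "\<exists>g. (\<forall>n. g n \<in> F) \<and> range g \<inter> range (\<lambda>n. g n + h n) = {} \<and>
      Kronecker_I0 (range g) \<and> Kronecker_I0 (range (\<lambda>n. g n + h n))"
      using g(1) by blast
  qed (use assms in auto)
next
  case (double c F')
  show ?thesis
  proof (intro exI[of _ F'] conjI allI impI)
    fix h assume hF: "\<forall>n :: nat. \<exists>a\<in>F'. \<exists>b\<in>F'. a \<noteq> b \<and> h n = a - b"
    then have h0: "h n \<noteq> 0" for n by (metis eq_iff_diff_eq_0)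
    have esc: "\<forall>S. finite S \<longrightarrow> (\<exists>g\<in>F'. g \<notin> generated S)" using double(4) by blast
    obtain \<Lambda> g where all: "\<forall>n :: nat. int_module.subspace (\<Lambda> n) \<and> \<Lambda> n \<subseteq> \<Lambda> (Suc n) \<and>
        g n \<in> F' \<and> g n \<notin> \<Lambda> n \<and> g n \<in> \<Lambda> (Suc n) \<and> h n \<in> \<Lambda> n \<and> c \<in> \<Lambda> n"
      using choose_escaping[where F = F' and Q = "\<lambda>H g. g \<notin> H" and h = h and c = c, OF esc]
      by (elim exE) (rule that)
    have sub: "int_module.subspace (\<Lambda> n)" and mono: "\<Lambda> n \<subseteq> \<Lambda> (Suc n)"
      and g: "g n \<in> F'" "g n \<notin> \<Lambda> n" "g n \<in> \<Lambda> (Suc n)"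
      and h: "h n \<in> \<Lambda> n" and c: "c \<in> \<Lambda> n" for n
      using all by blast+
    have h': "h n \<in> \<Lambda> (Suc n)" for n using h mono by blast
    have cancel: "a + b \<notin> \<Lambda> n" if "a \<notin> \<Lambda> n" "b \<in> \<Lambda> n" for a b n
      using int_module.subspace_diff[OF sub, of "a + b" n b] that by auto
    have hh: "h n + h n = 0" for n
    proof -
      obtain a b where ab: "a \<in> F'" "b \<in> F'" "h n = a - b" using hF by blast
      then have "h n + h n = (a + a) - (b + b)" by (simp add: algebra_simps)
      then show ?thesis using double(3) ab by simp
    qed
    have "g n + h n + (g n + h n) = g n + g n + (h n + h n)" for n by (simp add: algebra_simps)
    then have dbl: "g n + h n + (g n + h n) = c" for n using double(3)[OF g(1)] hh by simp
    have "Kronecker_I0 (range g)"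
      by (rule Kronecker_I0_of_constant_double[of \<Lambda> g, OF sub mono g(3) c g(2) double(3)[OF g(1)]])
    moreover have "Kronecker_I0 (range (\<lambda>n. g n + h n))"
      by (rule Kronecker_I0_of_constant_double[of \<Lambda> "\<lambda>n. g n + h n", OF sub mono _ c _ dbl])
        (use g h cancel int_module.subspace_add[OF sub g(3) h'] in auto)
    moreover have "range g \<inter> range (\<lambda>n. g n + h n) = {}"
      by (rule disjoint_translates_escaping[of \<Lambda> g h, OF sub mono]) (use g h h0 in auto)
    moreover have "g n \<in> F" for n using g(1) double(1) by blast
    ultimately show "\<exists>g. (\<forall>n. g n \<in> F) \<and> range g \<inter> range (\<lambda>n. g n + h n) = {} \<and>
      Kronecker_I0 (range g) \<and> Kronecker_I0 (range (\<lambda>n. g n + h n))"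
      by blast
  qed (use double in auto)
qed

theorem theorem1:
  fixes F :: "'a::ab_group_add set"
  assumes "infinite F"
  shows "\<exists>E E'. E \<subseteq> F \<and> E' \<subseteq> {f1 + f2 - f3 | f1 f2 f3. f1 \<in> F \<and> f2 \<in> F \<and> f3 \<in> F} \<and>
           countable E \<and> countable E' \<and> E \<inter> E' = {} \<and>
           I0_set E \<and> I0_set E' \<and> \<not> I0_set (E \<union> E') \<and>
           (\<exists>\<epsilon>\<le>sqrt 2. weak_Kronecker \<epsilon> E \<and> weak_Kronecker \<epsilon> E')"
proof -
  obtain F' where F': "F' \<subseteq> F" "infinite F'"
    and ex: "\<forall>h. (\<forall>n :: nat. \<exists>a\<in>F'. \<exists>b\<in>F'. a \<noteq> b \<and> h n = a - b) \<longrightarrow>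
      (\<exists>g. (\<forall>n. g n \<in> F) \<and> range g \<inter> range (\<lambda>n. g n + h n) = {} \<and>
        Kronecker_I0 (range g) \<and> Kronecker_I0 (range (\<lambda>n. g n + h n)))"
    using exists_translates[OF assms] by (elim exE conjE) (rule that)
  obtain f :: "nat \<Rightarrow> 'a" where f: "inj f" "range f \<subseteq> F'"
    using infinite_countable_subset[OF F'(2)] by blast
  \<comment> \<open>The code \<open>(i, k)\<close> stands for the pair with
    \<open>j = i + k + 1\<close>, so every pair \<open>i < j\<close> occurs.\<close>
  define h where "h n = (case prod_decode n of (i, k) \<Rightarrow> f i - f (i + k + 1))" for n
  have "\<exists>a\<in>F'. \<exists>b\<in>F'. a \<noteq> b \<and> h n = a - b" for n
  proof -
    obtain i k where ik: "prod_decode n = (i, k)" by (cases "prod_decode n")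
    have "f i \<noteq> f (i + k + 1)" using f(1) by (simp add: inj_eq)
    then show ?thesis using f(2) by (intro bexI[of _ "f i"] bexI[of _ "f (i + k + 1)"]) (auto simp: h_def ik)
  qed
  note hF = this
  then obtain g where g: "\<And>n. g n \<in> F" and disj: "range g \<inter> range (\<lambda>n. g n + h n) = {}"
    and K: "Kronecker_I0 (range g)" "Kronecker_I0 (range (\<lambda>n. g n + h n))"
    using spec[OF ex, of h] by blast
  have "\<not> I0_set (range g \<union> range (\<lambda>n. g n + h n))"
  proof (rule not_I0_set_union[OF disj, of f])
    fix i j :: nat assume "i < j"
    \<comment> \<open>Inverts the coding: \<open>k\<close> is \<open>j - i - 1\<close>.\<close>
    define n where "n = prod_encode (i, j - i - 1)"
    have "h n = f i - f j" using \<open>i < j\<close> by (simp add: n_def h_def)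
    then show "\<exists>a\<in>range g. a + (f i - f j) \<in> range (\<lambda>n. g n + h n)"
      by (intro bexI[of _ "g n"] range_eqI[of _ _ n]) auto
  qed
  moreover have "range (\<lambda>n. g n + h n) \<subseteq> {f1 + f2 - f3 | f1 f2 f3. f1 \<in> F \<and> f2 \<in> F \<and> f3 \<in> F}"
  proof clarify
    fix n
    obtain a b where "a \<in> F'" "b \<in> F'" "h n = a - b" using hF by blast
    then show "\<exists>f1 f2 f3. g n + h n = f1 + f2 - f3 \<and> f1 \<in> F \<and> f2 \<in> F \<and> f3 \<in> F"
      using g[of n] F'(1) by (intro exI[of _ "g n"] exI[of _ a] exI[of _ b]) auto
  qed
  ultimately show ?thesis
    using g disj K unfolding Kronecker_I0_def
    by (intro exI[of _ "range g"] exI[of _ "range (\<lambda>n. g n + h n)"] conjI exI[of _ "sqrt 2"]) auto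
qed

end
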